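(* Let $G$ be a countable sofic group and let $(X,G)$ be an expansive dynamical system with the weak specification property and the strong topological Markov property. Assume that $h_\Sigma(X,G) \geq 0$ for some sofic approximation $\Sigma$ of $G$. Suppose that $Y \subset X$ is a proper closed $G$-invariant subset. Then $h_\Sigma(Y,G) < h_\Sigma(X,G)$.
   Context: A dynamical system is a pair $(X,G)$ consisting of a compact metrizable space $X$ equipped with a continuous action of a countable group $G$ (i.e., $G$ acts by homeomorphisms). For a closed $G$-invariant subset $Y\subset X$, $(Y,G)$ denotes the dynamical system obtained by restricting the action. Fix a metric $\rho$ on $X$ compatible with the topology (none of the notions below depends on the choice of $\rho$). Expansive: there is a constant $c>0$ such that for all distinct $x,y\in X$ there exists $g \in G$ with $\rho(gx,gy)>c$. Weak specification property: for any $\varepsilon>0$ there exists a finite symmetric subset $F \subset G$ containing $1_G$ such that: if $(\Omega_i)_{i\in I}$ is any finite family of finite subsets of $G$ with $F\Omega_i \cap \Omega_j = \varnothing$ for all distinct $i,j\in I$, and $(x_i)_{i \in I}$ is any family of points in $X$, then there exists $x\in X$ such that $\rho(sx,sx_i)\le\varepsilon$ for all $i\in I$ and $s\in\Omega_i$. Strong topological Markov property: for any $\varepsilon>0$ there exist $\delta>0$ and a finite subset $F\subset G$ containing $1_G$ such that: given any finite subset $A\subset G$ and $x,y\in X$ with $\rho(sx,sy)\le\delta$ for all $s\in FA\setminus A$, there exists $z\in X$ with $\rho(sz,sx)\le\varepsilon$ for all $s\in FA$ and $\rho(sz,sy)\le\varepsilon$ for all $s\in G\setminus A$. Sofic approximations: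 for a positive integer $d$ write $[d]=\{1,\dots,d\}$, $\mathrm{Sym}(d)$ for the symmetric group of $[d]$, and $\eta_d(\sigma,\sigma') = \frac1d|\{a\in[d]:\sigma(a)\ne\sigma'(a)\}|$ for the normalized Hamming distance on $\mathrm{Sym}(d)$. A sofic approximation of a countable group $G$ is a sequence $\Sigma=(d_j,\sigma_j)_{j\in\mathbb N}$, where $d_j$ is a positive integer and $\sigma_j\colon G\to\mathrm{Sym}(d_j)$ is a map, such that $\lim_{j} d_j=+\infty$; $\lim_{j}\eta_{d_j}(\sigma_j(s)\sigma_j(t),\sigma_j(st))=0$ for all $s,t\in G$; and $\lim_{j}\eta_{d_j}(\sigma_j(s),\sigma_j(t))=1$ for all distinct $s,t\in G$. A countable group is sofic if it admits a sofic approximation. Sofic topological entropy: for $\varphi,\psi\colon[d]\to X$ set $\rho_2(\varphi,\psi)=\big(\frac1d\sum_{a\in[d]}\rho(\varphi(a),\psi(a))^2\big)^{1/2}$ and $\rho_\infty(\varphi,\psi)=\max_{a\in[d]}\rho(\varphi(a),\psi(a))$. For a nonempty finite $F\subset G$, $\delta>0$, and a map $\sigma\colon G\to\mathrm{Sym}(d)$, $s \mapsto \sigma_s$, let $\mathrm{Map}(X,\rho,F,\delta,\sigma)$ be the set of all $\varphi\colon[d]\to X$ such that $\rho_2(\varphi\circ\sigma_s,s\varphi)<\delta$ for all $s\in F$, where $(s\varphi)(a)=s\varphi(a)$. For $\varepsilon>0$ let $N_\varepsilon(\mathrm{Map}(X,\rho,F,\delta,\sigma),\rho_\infty)$ be the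 maximal cardinality of a subset of $\mathrm{Map}(X,\rho,F,\delta,\sigma)$ any two distinct elements of which are at $\rho_\infty$-distance $\ge\varepsilon$ (with $\log 0=-\infty$ when $\mathrm{Map}$ is empty). Then $$h_\Sigma(X,G)=\sup_{\varepsilon>0}\ \inf_{F}\ \inf_{\delta>0}\ \limsup_{j\to\infty}\frac1{d_j}\log N_\varepsilon(\mathrm{Map}(X,\rho,F,\delta,\sigma_j),\rho_\infty)\in\{-\infty\}\cup[0,\infty],$$ with $F$ ranging over nonempty finite subsets of $G$; $h_\Sigma(Y,G)$ is defined in the same way for the dynamical system $(Y,G)$. *)

theory Defs
  imports
    "HOL-Analysis.Analysis"
    "HOL-Algebra.Group_Action"
    "HOL-Algebra.Sym_Groups"
    "HOL-Library.Extended_Nat"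
    "HOL-Library.Extended_Real"
begin

text \<open>
  The phase space is a compact subset \<open>X\<close> of a metric type, the fixed compatible metric being
  \<open>dist\<close>.  The action is a \<open>group_action\<close>, i.e. a homomorphism from \<open>G\<close> into the group of
  (extensional) bijections of \<open>X\<close>; since inverses also act continuously, continuity of each
  \<open>\<alpha> g\<close> makes \<open>G\<close> act by homeomorphisms.
\<close>

definition dynamical_system ::
    "('g, 'm) monoid_scheme \<Rightarrow> 'a::metric_space set \<Rightarrow> ('g \<Rightarrow> 'a \<Rightarrow> 'a) \<Rightarrow> bool" where
  "dynamical_system G X \<alpha> \<longleftrightarrow>
     countable (carrier G) \<and> compact X \<and> group_action G X \<alpha> \<and>
     (\<forall>g\<in>carrier G. continuous_on X (\<alpha> g))"

definition invariant_subset ::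
    "('g, 'm) monoid_scheme \<Rightarrow> ('g \<Rightarrow> 'a \<Rightarrow> 'a) \<Rightarrow> 'a set \<Rightarrow> bool" where
  "invariant_subset G \<alpha> Y \<longleftrightarrow> (\<forall>g\<in>carrier G. \<alpha> g ` Y \<subseteq> Y)"

definition restrict_action :: "('g \<Rightarrow> 'a \<Rightarrow> 'a) \<Rightarrow> 'a set \<Rightarrow> 'g \<Rightarrow> 'a \<Rightarrow> 'a" where
  "restrict_action \<alpha> Y = (\<lambda>g. restrict (\<alpha> g) Y)"

definition expansive ::
    "('g, 'm) monoid_scheme \<Rightarrow> 'a::metric_space set \<Rightarrow> ('g \<Rightarrow> 'a \<Rightarrow> 'a) \<Rightarrow> bool" where
  "expansive G X \<alpha> \<longleftrightarrow>
     (\<exists>c>0. \<forall>x\<in>X. \<forall>y\<in>X. x \<noteq> y \<longrightarrow> (\<exists>g\<in>carrier G. dist (\<alpha> g x) (\<alpha> g y) > c))"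

text \<open>Finite families are indexed by finite sets \<open>I\<close> of natural numbers.\<close>

definition weak_specification ::
    "('g, 'm) monoid_scheme \<Rightarrow> 'a::metric_space set \<Rightarrow> ('g \<Rightarrow> 'a \<Rightarrow> 'a) \<Rightarrow> bool" where
  "weak_specification G X \<alpha> \<longleftrightarrow>
     (\<forall>\<epsilon>>0. \<exists>F. finite F \<and> F \<subseteq> carrier G \<and> \<one>\<^bsub>G\<^esub> \<in> F \<and> (\<forall>s\<in>F. inv\<^bsub>G\<^esub> s \<in> F) \<and>
        (\<forall>(I :: nat set) \<Omega> x.
           finite I \<longrightarrow>
           (\<forall>i\<in>I. finite (\<Omega> i) \<and> \<Omega> i \<subseteq> carrier G) \<longrightarrow>
           (\<forall>i\<in>I. \<forall>j\<in>I. i \<noteq> j \<longrightarrow> (F <#>\<^bsub>G\<^esub> \<Omega> i) \<inter> \<Omega> j = {}) \<longrightarrow>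
           (\<forall>i\<in>I. x i \<in> X) \<longrightarrow>
           (\<exists>z\<in>X. \<forall>i\<in>I. \<forall>s\<in>\<Omega> i. dist (\<alpha> s z) (\<alpha> s (x i)) \<le> \<epsilon>)))"

definition strong_topological_Markov ::
    "('g, 'm) monoid_scheme \<Rightarrow> 'a::metric_space set \<Rightarrow> ('g \<Rightarrow> 'a \<Rightarrow> 'a) \<Rightarrow> bool" where
  "strong_topological_Markov G X \<alpha> \<longleftrightarrow>
     (\<forall>\<epsilon>>0. \<exists>\<delta>>0. \<exists>F. finite F \<and> F \<subseteq> carrier G \<and> \<one>\<^bsub>G\<^esub> \<in> F \<and>
        (\<forall>A. finite A \<longrightarrow> A \<subseteq> carrier G \<longrightarrow>
           (\<forall>x\<in>X. \<forall>y\<in>X.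
              (\<forall>s\<in>(F <#>\<^bsub>G\<^esub> A) - A. dist (\<alpha> s x) (\<alpha> s y) \<le> \<delta>) \<longrightarrow>
              (\<exists>z\<in>X. (\<forall>s\<in>F <#>\<^bsub>G\<^esub> A. dist (\<alpha> s z) (\<alpha> s x) \<le> \<epsilon>) \<and>
                     (\<forall>s\<in>carrier G - A. dist (\<alpha> s z) (\<alpha> s y) \<le> \<epsilon>)))))"

definition hamming_dist :: "nat \<Rightarrow> (nat \<Rightarrow> nat) \<Rightarrow> (nat \<Rightarrow> nat) \<Rightarrow> real" where
  "hamming_dist d p q = real (card {a \<in> {1..d}. p a \<noteq> q a}) / real d"

definition sofic_approximation ::
    "('g, 'm) monoid_scheme \<Rightarrow> (nat \<Rightarrow> nat) \<Rightarrow> (nat \<Rightarrow> 'g \<Rightarrow> nat \<Rightarrow> nat) \<Rightarrow> bool" where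
  "sofic_approximation G d \<sigma> \<longleftrightarrow>
     (\<forall>j. d j > 0) \<and>
     (\<forall>j. \<forall>s\<in>carrier G. \<sigma> j s \<in> carrier (sym_group (d j))) \<and>
     filterlim d at_top sequentially \<and>
     (\<forall>s\<in>carrier G. \<forall>t\<in>carrier G.
        (\<lambda>j. hamming_dist (d j) (\<sigma> j s \<otimes>\<^bsub>sym_group (d j)\<^esub> \<sigma> j t) (\<sigma> j (s \<otimes>\<^bsub>G\<^esub> t)))
          \<longlonglongrightarrow> 0) \<and>
     (\<forall>s\<in>carrier G. \<forall>t\<in>carrier G. s \<noteq> t \<longrightarrow>
        (\<lambda>j. hamming_dist (d j) (\<sigma> j s) (\<sigma> j t)) \<longlonglongrightarrow> 1)"

definition countable_sofic_group :: "('g, 'm) monoid_scheme \<Rightarrow> bool" where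
  "countable_sofic_group G \<longleftrightarrow>
     group G \<and> countable (carrier G) \<and> (\<exists>d \<sigma>. sofic_approximation G d \<sigma>)"

definition rho2 :: "nat \<Rightarrow> (nat \<Rightarrow> 'a::metric_space) \<Rightarrow> (nat \<Rightarrow> 'a) \<Rightarrow> real" where
  "rho2 d \<phi> \<psi> = sqrt ((\<Sum>a\<in>{1..d}. (dist (\<phi> a) (\<psi> a))\<^sup>2) / real d)"

definition rho_inf :: "nat \<Rightarrow> (nat \<Rightarrow> 'a::metric_space) \<Rightarrow> (nat \<Rightarrow> 'a) \<Rightarrow> real" where
  "rho_inf d \<phi> \<psi> = Max ((\<lambda>a. dist (\<phi> a) (\<psi> a)) ` {1..d})"

text \<open>
  Maps \<open>[d] \<rightarrow> X\<close> are extensional functions on \<open>{1..d}\<close>, so that they are determined by their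
  values on \<open>{1..d}\<close> and the counting below is the intended one.
\<close>

definition Map_sofic ::
    "('g \<Rightarrow> 'a::metric_space \<Rightarrow> 'a) \<Rightarrow> 'a set \<Rightarrow> 'g set \<Rightarrow> real \<Rightarrow> nat \<Rightarrow> ('g \<Rightarrow> nat \<Rightarrow> nat) \<Rightarrow>
     (nat \<Rightarrow> 'a) set" where
  "Map_sofic \<alpha> X F \<delta> d \<sigma> =
     {\<phi> \<in> {1..d} \<rightarrow>\<^sub>E X. \<forall>s\<in>F. rho2 d (\<phi> \<circ> \<sigma> s) (\<lambda>a. \<alpha> s (\<phi> a)) < \<delta>}"

text \<open>
  The supremum over finite separated subsets is the maximal cardinality of a separated subset
  whenever the latter is finite (as it is for maps into a compact space), and \<open>\<infinity>\<close> otherwise.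
\<close>

definition sep_number :: "nat \<Rightarrow> real \<Rightarrow> (nat \<Rightarrow> 'a::metric_space) set \<Rightarrow> enat" where
  "sep_number d \<epsilon> M =
     (SUP S \<in> {S. S \<subseteq> M \<and> finite S \<and> pairwise (\<lambda>\<phi> \<psi>. rho_inf d \<phi> \<psi> \<ge> \<epsilon>) S}. enat (card S))"

definition log_enat :: "enat \<Rightarrow> ereal" where
  "log_enat n =
     (if n = 0 then -\<infinity> else case n of enat k \<Rightarrow> ereal (ln (real k)) | \<infinity> \<Rightarrow> \<infinity>)"

definition sofic_entropy ::
    "('g, 'm) monoid_scheme \<Rightarrow> (nat \<Rightarrow> nat) \<Rightarrow> (nat \<Rightarrow> 'g \<Rightarrow> nat \<Rightarrow> nat) \<Rightarrow>
     'a::metric_space set \<Rightarrow> ('g \<Rightarrow> 'a \<Rightarrow> 'a) \<Rightarrow> ereal" where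
  "sofic_entropy G d \<sigma> X \<alpha> =
     (SUP \<epsilon>\<in>{0<..}.
        INF F\<in>{F. finite F \<and> F \<noteq> {} \<and> F \<subseteq> carrier G}.
          INF \<delta>\<in>{0<..}.
            limsup (\<lambda>j. ereal (1 / real (d j)) *
                        log_enat (sep_number (d j) \<epsilon> (Map_sofic \<alpha> X F \<delta> (d j) (\<sigma> j)))))"

end

theory Submission
  imports Defs
begin

text \<open>
  The idea is to produce, from each approximately equivariant map into \<open>Y\<close>, exponentially many
  approximately equivariant maps into \<open>X\<close>.  Fix \<open>x0 \<in> X - Y\<close>.  Given \<open>\<phi> : {1..n} \<rightarrow> Y\<close> and a well separated
  set \<open>V\<close> of positive density in \<open>{1..n}\<close>, one changes \<open>\<phi>\<close> near the points of a subset \<open>W\<close> of \<open>V\<close> so that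
  the new map is close to \<open>x0\<close> on \<open>W\<close>, close to \<open>\<phi>\<close> away from \<open>W\<close>, and close to \<open>Y\<close> on \<open>V - W\<close>.

  The main difficulty is that the new map must be as equivariant as is required by the definition of
  entropy, while the separation of \<open>V\<close>, which determines the gain, may not depend on the required
  accuracy.  Weak specification and the Markov property together allow a replacement at arbitrarily
  many places of an orbit with a fixed error \<open>\<epsilon>\<close> and a fixed separation (\<open>local_replacement\<close>).  Doing
  this around each point gives a map that is equivariant up to \<open>4 \<epsilon>\<close> along a window as long as one
  wishes, and expansiveness improves this to any accuracy (\<open>surgery\<close>).

  Counting is now simple (\<open>many_models\<close>).  The set \<open>W\<close> can be read off from the new map, since \<open>x0\<close> is far
  from \<open>Y\<close>, and \<open>\<phi>\<close> is lost on at most \<open>|F0| |W|\<close> coordinates only, for a fixed finite set \<open>F0\<close>.  So a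
  separated family of maps into \<open>Y\<close> is multiplied by
  \<open>\<Sum>W\<subseteq>V. x ^ card W = (1 + x) ^ card V\<close> with a constant \<open>x > 0\<close>, up to the few points of \<open>V\<close> that are bad
  for the map.  The separation scale of the given family may be arbitrarily small, but by expansiveness
  it can be brought to a fixed scale at a negligible exponential cost (\<open>thin_to_expansive_scale\<close>).
  Hence the entropy of \<open>Y\<close> is smaller, by a fixed amount, than the entropy of \<open>X\<close> at a fixed scale, and
  the latter is finite.
\<close>

section \<open>Counting\<close>

lemma sum_Pow_power_card:
  fixes x :: real
  assumes "finite A"
  shows "(\<Sum>W\<in>Pow A. x ^ card W) = (1 + x) ^ card A"
  using prod_add[OF assms, of "\<lambda>_. x" "\<lambda>_. 1"] by (simp add: add.commute)

lemma sum_swap_filter: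
  fixes g :: "'w \<Rightarrow> real"
  assumes "finite A" and "finite S"
  shows "(\<Sum>W\<in>A. g W * real (card {\<phi> \<in> S. R W \<phi>})) = (\<Sum>\<phi>\<in>S. \<Sum>W | W \<in> A \<and> R W \<phi>. g W)"
proof -
  have "(\<Sum>W\<in>A. g W * real (card {\<phi> \<in> S. R W \<phi>})) = (\<Sum>W\<in>A. \<Sum>\<phi>\<in>S. if R W \<phi> then g W else 0)"
    using assms(2) by (intro sum.cong refl) (simp add: sum.inter_filter[symmetric])
  also have "\<dots> = (\<Sum>\<phi>\<in>S. \<Sum>W\<in>A. if R W \<phi> then g W else 0)" by (rule sum.swap)
  also have "\<dots> = (\<Sum>\<phi>\<in>S. \<Sum>W | W \<in> A \<and> R W \<phi>. g W)"
    by (simp add: sum.inter_filter[OF assms(1)])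
  finally show ?thesis .
qed

text \<open>
  A maximal independent set in the graph that joins each \<open>v\<close> to the points \<open>p k v\<close> is
  large, because every vertex has at most \<open>2 |K|\<close> neighbours and every point of \<open>P\<close> lies in the set or
  is a neighbour of it.
\<close>

lemma large_independent_set:
  fixes p :: "'k \<Rightarrow> 'v \<Rightarrow> 'v"
  assumes "finite K" and "finite P"
    and inj: "\<And>k. k \<in> K \<Longrightarrow> inj (p k)"
    and nofix: "\<And>k v. k \<in> K \<Longrightarrow> v \<in> P \<Longrightarrow> p k v \<noteq> v"
  obtains V where "V \<subseteq> P" and "\<And>k v. k \<in> K \<Longrightarrow> v \<in> V \<Longrightarrow> p k v \<notin> V"
    and "card P \<le> (2 * card K + 1) * card V"
proof -
  define indep where "indep = {V. V \<subseteq> P \<and> (\<forall>k\<in>K. \<forall>v\<in>V. p k v \<notin> V)}"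
  have "finite indep"
    by (rule finite_subset[of _ "Pow P"]) (use \<open>finite P\<close> in \<open>auto simp: indep_def\<close>)
  moreover have "{} \<in> indep" by (auto simp: indep_def)
  ultimately obtain V where V: "V \<in> indep" and maxV: "\<And>U. U \<in> indep \<Longrightarrow> V \<subseteq> U \<Longrightarrow> U = V"
    using finite_has_maximal[of indep] by (metis empty_iff)
  have "finite V" using V \<open>finite P\<close> finite_subset by (auto simp: indep_def)
  have cover: "P \<subseteq> V \<union> (\<Union>k\<in>K. p k ` V \<union> p k -` V)"
  proof
    fix v assume v: "v \<in> P"
    show "v \<in> V \<union> (\<Union>k\<in>K. p k ` V \<union> p k -` V)"
    proof (rule ccontr)
      assume not: "v \<notin> V \<union> (\<Union>k\<in>K. p k ` V \<union> p k -` V)"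
      have "insert v V \<in> indep"
        using V v not nofix by (auto simp: indep_def)
      then have "insert v V = V" using maxV by blast
      then show False using not by blast
    qed
  qed
  have finp: "finite (p k -` V)" if "k \<in> K" for k
    using finite_vimageI[OF \<open>finite V\<close> inj[OF that]] .
  have "card P \<le> card (V \<union> (\<Union>k\<in>K. p k ` V \<union> p k -` V))"
    by (rule card_mono[OF _ cover]) (use \<open>finite V\<close> \<open>finite K\<close> finp in auto)
  also have "\<dots> \<le> card V + card (\<Union>k\<in>K. p k ` V \<union> p k -` V)"
    by (rule card_Un_le)
  also have "card (\<Union>k\<in>K. p k ` V \<union> p k -` V) \<le> (\<Sum>k\<in>K. card (p k ` V \<union> p k -` V))"
    by (rule card_UN_le[OF \<open>finite K\<close>])
  also have "(\<Sum>k\<in>K. card (p k ` V \<union> p k -` V)) \<le> (\<Sum>k\<in>K. 2 * card V)"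
  proof (rule sum_mono)
    fix k assume k: "k \<in> K"
    have "card (p k ` V \<union> p k -` V) \<le> card (p k ` V) + card (p k -` V)" by (rule card_Un_le)
    also have "\<dots> \<le> card V + card V"
      using card_image_le[OF \<open>finite V\<close>] card_vimage_inj_on_le[OF inj[OF k] \<open>finite V\<close>]
      by (intro add_mono) auto
    finally show "card (p k ` V \<union> p k -` V) \<le> 2 * card V" by simp
  qed
  finally have "card P \<le> (2 * card K + 1) * card V" by (simp add: algebra_simps)
  then show ?thesis using that V by (auto simp: indep_def)
qed

text \<open>
  For \<open>t\<close> at most \<open>1\<close>, the weight \<open>t powr (card B - m)\<close> is at least \<open>1\<close> on the sets with at most
  \<open>m\<close> elements; summing it over all sets turns the count into a binomial expansion.
\<close>

lemma sum_small_subsets_le: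
  fixes C t m :: real
  assumes "finite A" and "0 \<le> C" and "0 < t" and "t \<le> 1"
  shows "(\<Sum>B | B \<subseteq> A \<and> real (card B) \<le> m. C ^ card B) \<le> t powr (- m) * (1 + C * t) ^ card A"
proof -
  have "(\<Sum>B | B \<subseteq> A \<and> real (card B) \<le> m. C ^ card B)
      \<le> (\<Sum>B | B \<subseteq> A \<and> real (card B) \<le> m. t powr (- m) * (C * t) ^ card B)"
  proof (rule sum_mono)
    fix B assume "B \<in> {B. B \<subseteq> A \<and> real (card B) \<le> m}"
    then have "1 \<le> t powr (real (card B) - m)"
      using assms powr_mono'[of "real (card B) - m" 0 t] by simp
    also have "\<dots> = t powr (- m) * t ^ card B"
      using assms by (simp add: powr_diff powr_minus powr_realpow field_simps)
    finally have "C ^ card B * 1 \<le> C ^ card B * (t powr (- m) * t ^ card B)"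
      using assms by (intro mult_left_mono) auto
    then show "C ^ card B \<le> t powr (- m) * (C * t) ^ card B"
      by (simp add: power_mult_distrib algebra_simps)
  qed
  also have "\<dots> \<le> (\<Sum>B\<in>Pow A. t powr (- m) * (C * t) ^ card B)"
    by (rule sum_mono2) (use assms in auto)
  also have "\<dots> = t powr (- m) * (1 + C * t) ^ card A"
    by (simp add: sum_distrib_left[symmetric] sum_Pow_power_card[OF assms(1)])
  finally show ?thesis .
qed

text \<open>
  The preceding bound is used with \<open>t\<close> so small that \<open>C t \<le> \<eta> / 2\<close>, and with \<open>\<kappa>\<close> chosen after \<open>t\<close> such
  that \<open>t powr (- \<kappa>) \<le> exp (\<eta> / 2)\<close>: changing few coordinates arbitrarily has a small exponential cost.
\<close>

lemma small_subsets_rate: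
  fixes C \<eta> :: real
  assumes "0 < C" and "0 < \<eta>"
  obtains \<kappa> where "0 < \<kappa>"
    and "\<And>n. (\<Sum>B | B \<subseteq> {1..n::nat} \<and> real (card B) \<le> \<kappa> * real n. C ^ card B) \<le> exp (\<eta> * real n)"
proof -
  define t where "t = min 1 (\<eta> / (2 * C))"
  define \<kappa> where "\<kappa> = \<eta> / 2 / (1 - ln t)"
  have t: "0 < t" "t \<le> 1" "C * t \<le> \<eta> / 2"
    using assms by (auto simp: t_def min_def field_simps)
  have lnt: "ln t \<le> 0" using t by simp
  have \<kappa>: "0 < \<kappa>" using assms lnt by (simp add: \<kappa>_def)
  have "1 - ln t \<noteq> 0" using lnt by linarith
  then have "\<kappa> * (1 - ln t) = \<eta> / 2" by (metis \<kappa>_def eq_divide_eq)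
  then have k2: "\<kappa> * (- ln t) \<le> \<eta> / 2" using \<kappa> by (simp add: algebra_simps)
  show ?thesis
  proof (rule that[OF \<kappa>])
    fix n :: nat
    have "t powr (- (\<kappa> * real n)) = exp (\<kappa> * (- ln t) * real n)"
      using t by (simp add: powr_def)
    also have "\<dots> \<le> exp (\<eta> / 2 * real n)"
      using mult_right_mono[OF k2, of "real n"] by simp
    finally have 1: "t powr (- (\<kappa> * real n)) \<le> exp (\<eta> / 2 * real n)" .
    have "(1 + C * t) ^ card {1..n} \<le> exp (C * t) ^ card {1..n}"
      using assms t by (intro power_mono exp_ge_add_one_self) auto
    also have "\<dots> = exp (C * t * real n)" by (simp add: exp_of_nat_mult[symmetric] mult.commute)
    also have "\<dots> \<le> exp (\<eta> / 2 * real n)" using mult_right_mono[OF t(3), of "real n"] by simp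
    finally have 2: "(1 + C * t) ^ card {1..n} \<le> exp (\<eta> / 2 * real n)" .
    have "(\<Sum>B | B \<subseteq> {1..n} \<and> real (card B) \<le> \<kappa> * real n. C ^ card B)
        \<le> t powr (- (\<kappa> * real n)) * (1 + C * t) ^ card {1..n}"
      by (rule sum_small_subsets_le) (use assms t in auto)
    also have "\<dots> \<le> exp (\<eta> / 2 * real n) * exp (\<eta> / 2 * real n)"
      using 1 2 assms t by (intro mult_mono) auto
    also have "\<dots> = exp (\<eta> * real n)"
      by (simp add: exp_add[symmetric])
    finally show "(\<Sum>B | B \<subseteq> {1..n} \<and> real (card B) \<le> \<kappa> * real n. C ^ card B) \<le> exp (\<eta> * real n)" .
  qed
qed

section \<open>Separated families of maps\<close>

lemma rho_inf_less_iff: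
  assumes "0 < n"
  shows "rho_inf n \<phi> \<psi> < e \<longleftrightarrow> (\<forall>a\<in>{1..n}. dist (\<phi> a) (\<psi> a) < e)"
  unfolding rho_inf_def using assms by (subst Max_less_iff) auto

lemma rho_inf_ge_iff:
  assumes "0 < n"
  shows "e \<le> rho_inf n \<phi> \<psi> \<longleftrightarrow> (\<exists>a\<in>{1..n}. e \<le> dist (\<phi> a) (\<psi> a))"
  using rho_inf_less_iff[OF assms, of \<phi> \<psi> e] by (auto simp: not_less[symmetric])

text \<open>A finite code for the points of a compact set, exact up to \<open>e\<close>.\<close>

lemma compact_finite_code:
  fixes X :: "'a::metric_space set"
  assumes "compact X" and "0 < e"
  obtains N and f :: "'a \<Rightarrow> 'a" where "finite N" and "N \<noteq> {}" and "f \<in> X \<rightarrow> N"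
    and "\<And>x y. x \<in> X \<Longrightarrow> y \<in> X \<Longrightarrow> f x = f y \<Longrightarrow> dist x y < e"
proof -
  obtain N0 where N0: "finite N0" "X \<subseteq> (\<Union>x\<in>N0. ball x (e / 2))"
    using assms half_gt_zero[of e] unfolding compact_eq_totally_bounded by blast
  define f where "f x = (SOME u. u \<in> N0 \<and> x \<in> ball u (e / 2))" for x
  have f: "f x \<in> N0 \<and> x \<in> ball (f x) (e / 2)" if "x \<in> X" for x
    unfolding f_def by (rule someI_ex) (use N0 that in blast)
  show ?thesis
  proof (rule that[of "insert undefined N0" f])
    fix x y assume "x \<in> X" "y \<in> X" "f x = f y"
    then have "dist (f x) x < e / 2" "dist (f x) y < e / 2" using f by (metis mem_ball)+
    then show "dist x y < e" by (metis dist_triangle_half_r)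
  qed (use f N0 in auto)
qed

lemma enat_Sup_attained:
  fixes A :: "enat set"
  assumes "A \<noteq> {}" and "Sup A \<noteq> \<infinity>"
  shows "Sup A \<in> A"
proof -
  have "finite A" using assms by (auto simp: Sup_enat_def split: if_splits)
  then show ?thesis using assms Max_in[of A] by (simp add: Sup_enat_def)
qed

lemma sep_number_attained:
  assumes "sep_number n e M \<noteq> \<infinity>"
  obtains S where "S \<subseteq> M" and "finite S" and "pairwise (\<lambda>\<phi> \<psi>. rho_inf n \<phi> \<psi> \<ge> e) S"
    and "sep_number n e M = enat (card S)"
proof -
  let ?F = "{S. S \<subseteq> M \<and> finite S \<and> pairwise (\<lambda>\<phi> \<psi>. rho_inf n \<phi> \<psi> \<ge> e) S}"
  let ?A = "(\<lambda>S. enat (card S)) ` ?F"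
  have ne: "?A \<noteq> {}" by (auto intro!: exI[of _ "{}"])
  have "Sup ?A \<in> ?A"
    using enat_Sup_attained[OF ne] assms by (simp only: sep_number_def not_False_eq_True)
  then obtain S where "S \<in> ?F" "Sup ?A = enat (card S)" by blast
  then show ?thesis using that[of S] by (simp add: sep_number_def)
qed

lemma sep_number_ge:
  assumes "S \<subseteq> M" and "finite S" and "pairwise (\<lambda>\<phi> \<psi>. rho_inf n \<phi> \<psi> \<ge> e) S"
  shows "enat (card S) \<le> sep_number n e M"
  unfolding sep_number_def by (rule SUP_upper) (use assms in auto)

lemma sep_number_le_code:
  fixes f :: "'a::metric_space \<Rightarrow> 'b"
  assumes "0 < n" and M: "M \<subseteq> {1..n} \<rightarrow>\<^sub>E X" and "finite N" and f: "f \<in> X \<rightarrow> N"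
    and code: "\<And>x y. x \<in> X \<Longrightarrow> y \<in> X \<Longrightarrow> f x = f y \<Longrightarrow> dist x y < e"
  shows "sep_number n e M \<le> enat (card N ^ n)"
  unfolding sep_number_def
proof (rule SUP_least)
  fix S assume "S \<in> {S. S \<subseteq> M \<and> finite S \<and> pairwise (\<lambda>\<phi> \<psi>. rho_inf n \<phi> \<psi> \<ge> e) S}"
  then have S: "S \<subseteq> M" "finite S" and sep: "pairwise (\<lambda>\<phi> \<psi>. rho_inf n \<phi> \<psi> \<ge> e) S" by auto
  have val: "\<phi> a \<in> X" if "\<phi> \<in> S" "a \<in> {1..n}" for \<phi> a using S M that by blast
  have "card S \<le> card ({1..n} \<rightarrow>\<^sub>E N)"
  proof (rule card_inj_on_le)
    show "inj_on (\<lambda>\<phi>. restrict (f \<circ> \<phi>) {1..n}) S"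
    proof (rule inj_onI, rule ccontr)
      fix \<phi> \<psi> assume *: "\<phi> \<in> S" "\<psi> \<in> S" "\<phi> \<noteq> \<psi>"
        "restrict (f \<circ> \<phi>) {1..n} = restrict (f \<circ> \<psi>) {1..n}"
      then have "\<exists>a\<in>{1..n}. e \<le> dist (\<phi> a) (\<psi> a)"
        using sep by (simp add: pairwise_def rho_inf_ge_iff[OF \<open>0 < n\<close>] del: One_nat_def)
      then obtain a where a: "a \<in> {1..n}" "e \<le> dist (\<phi> a) (\<psi> a)" by blast
      have "f (\<phi> a) = f (\<psi> a)" using fun_cong[OF *(4), of a] a by simp
      then show False using code[of "\<phi> a" "\<psi> a"] val[of \<phi> a] val[of \<psi> a] * a by auto
    qed
    show "(\<lambda>\<phi>. restrict (f \<circ> \<phi>) {1..n}) ` S \<subseteq> {1..n} \<rightarrow>\<^sub>E N"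
      using val f by (auto simp: PiE_def Pi_def)
    show "finite ({1..n} \<rightarrow>\<^sub>E N)" using \<open>finite N\<close> by (intro finite_PiE) auto
  qed
  then show "enat (card S) \<le> enat (card N ^ n)" by (simp add: card_PiE)
qed

lemma maximal_separated_subset:
  assumes "0 < n" and "0 < e" and "finite (S :: (nat \<Rightarrow> 'a::metric_space) set)"
  obtains T where "T \<subseteq> S" and "pairwise (\<lambda>\<phi> \<psi>. rho_inf n \<phi> \<psi> \<ge> e) T"
    and "S \<subseteq> (\<Union>\<phi>\<in>T. {\<psi> \<in> S. rho_inf n \<phi> \<psi> < e})"
proof -
  let ?F = "{T. T \<subseteq> S \<and> pairwise (\<lambda>\<phi> \<psi>. rho_inf n \<phi> \<psi> \<ge> e) T}"
  have "finite ?F" by (rule finite_subset[of _ "Pow S"]) (use assms in auto)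
  moreover have "{} \<in> ?F" by simp
  ultimately obtain T where T: "T \<in> ?F" and maxT: "\<And>U. U \<in> ?F \<Longrightarrow> T \<subseteq> U \<Longrightarrow> U = T"
    using finite_has_maximal[of ?F] by (metis (no_types, lifting) empty_iff)
  have sym: "rho_inf n \<phi> \<psi> = rho_inf n \<psi> \<phi>" for \<phi> \<psi> :: "nat \<Rightarrow> 'a"
    by (simp add: rho_inf_def dist_commute)
  have "\<exists>\<phi>\<in>T. rho_inf n \<phi> \<psi> < e" if \<psi>: "\<psi> \<in> S" for \<psi>
  proof (rule ccontr)
    assume not: "\<not> ?thesis"
    then have "insert \<psi> T \<in> ?F" using T \<psi> sym by (auto simp: pairwise_insert not_less)
    then have "\<psi> \<in> T" using maxT[of "insert \<psi> T"] by blast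
    moreover have "rho_inf n \<psi> \<psi> < e" using assms by (simp add: rho_inf_less_iff)
    ultimately show False using not by blast
  qed
  then show ?thesis using T by (intro that[of T]) auto
qed

text \<open>
  Forgetting what happens on a set \<open>Q\<close> merges at most \<open>|N| ^ |Q|\<close> maps of a separated family: the maps
  whose codes agree on \<open>Q\<close> can only be separated outside \<open>Q\<close>.
\<close>

lemma separated_outside:
  fixes f :: "'a::metric_space \<Rightarrow> 'b"
  assumes "0 < n" and val: "\<And>\<phi> a. \<phi> \<in> S \<Longrightarrow> a \<in> {1..n} \<Longrightarrow> \<phi> a \<in> X"
    and "finite S" and sep: "pairwise (\<lambda>\<phi> \<psi>. rho_inf n \<phi> \<psi> \<ge> e) S"
    and "finite N" and "N \<noteq> {}" and f: "f \<in> X \<rightarrow> N"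
    and code: "\<And>x y. x \<in> X \<Longrightarrow> y \<in> X \<Longrightarrow> f x = f y \<Longrightarrow> dist x y < e"
    and Q: "Q \<subseteq> {1..n}"
  obtains T where "T \<subseteq> S" and "real (card S) \<le> real (card N) ^ card Q * real (card T)"
    and "\<And>\<phi> \<psi>. \<phi> \<in> T \<Longrightarrow> \<psi> \<in> T \<Longrightarrow> \<phi> \<noteq> \<psi> \<Longrightarrow> \<exists>a\<in>{1..n} - Q. e \<le> dist (\<phi> a) (\<psi> a)"
proof -
  have "finite Q" using Q finite_subset by blast
  let ?r = "\<lambda>\<phi>. restrict (f \<circ> \<phi>) Q"
  have "\<exists>y\<in>Q \<rightarrow>\<^sub>E N. card (?r -` {y} \<inter> S) * card (Q \<rightarrow>\<^sub>E N) \<ge> card S"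
  proof (rule pigeonhole_card)
    show "?r \<in> S \<rightarrow> (Q \<rightarrow>\<^sub>E N)" using val f Q by (force simp: PiE_def Pi_def)
    show "finite (Q \<rightarrow>\<^sub>E N)" using \<open>finite Q\<close> \<open>finite N\<close> by (intro finite_PiE) auto
    show "Q \<rightarrow>\<^sub>E N \<noteq> {}" using \<open>N \<noteq> {}\<close> by (auto simp: PiE_eq_empty_iff)
  qed fact
  then obtain y where y: "card S \<le> card (?r -` {y} \<inter> S) * card N ^ card Q"
    by (simp only: card_PiE[OF \<open>finite Q\<close>] prod_constant) blast
  show ?thesis
  proof (rule that[of "?r -` {y} \<inter> S"])
    show "real (card S) \<le> real (card N) ^ card Q * real (card (?r -` {y} \<inter> S))"
      using y by (metis mult.commute of_nat_le_iff of_nat_mult of_nat_power)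
    fix \<phi> \<psi> assume *: "\<phi> \<in> ?r -` {y} \<inter> S" "\<psi> \<in> ?r -` {y} \<inter> S" "\<phi> \<noteq> \<psi>"
    then have "\<exists>a\<in>{1..n}. e \<le> dist (\<phi> a) (\<psi> a)"
      using sep by (simp add: pairwise_def rho_inf_ge_iff[OF \<open>0 < n\<close>] del: One_nat_def)
    then obtain a where a: "a \<in> {1..n}" "e \<le> dist (\<phi> a) (\<psi> a)" by blast
    have "a \<notin> Q"
    proof
      assume "a \<in> Q"
      have "?r \<phi> = ?r \<psi>" using * by auto
      from fun_cong[OF this, of a] have "f (\<phi> a) = f (\<psi> a)" using \<open>a \<in> Q\<close> by simp
      then show False using code[of "\<phi> a" "\<psi> a"] val[of \<phi> a] val[of \<psi> a] * a by auto
    qed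
    then show "\<exists>a\<in>{1..n} - Q. e \<le> dist (\<phi> a) (\<psi> a)" using a by blast
  qed blast
qed

section \<open>Expansive actions and local replacement\<close>

locale compact_action = group_action G X \<alpha> + group G
  for G :: "('g, 'm) monoid_scheme" (structure) and X :: "'a::metric_space set"
    and \<alpha> :: "'g \<Rightarrow> 'a \<Rightarrow> 'a" +
  assumes compact_space: "compact X"
    and continuous_act: "\<And>g. g \<in> carrier G \<Longrightarrow> continuous_on X (\<alpha> g)"
begin

lemma act_closed [simp, intro]: "g \<in> carrier G \<Longrightarrow> x \<in> X \<Longrightarrow> \<alpha> g x \<in> X"
  using element_image by blast

lemma act_act: "g \<in> carrier G \<Longrightarrow> h \<in> carrier G \<Longrightarrow> x \<in> X \<Longrightarrow> \<alpha> g (\<alpha> h x) = \<alpha> (g \<otimes> h) x"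
  using composition_rule by simp

lemma act_one [simp]: "x \<in> X \<Longrightarrow> \<alpha> \<one> x = x"
  using id_eq_one by (metis restrict_apply')

lemma uniformly_continuous_finite:
  assumes "finite E" and "E \<subseteq> carrier G" and "0 < (\<tau>::real)"
  obtains \<delta> where "0 < \<delta>"
    and "\<And>h x y. h \<in> E \<Longrightarrow> x \<in> X \<Longrightarrow> y \<in> X \<Longrightarrow> dist x y < \<delta> \<Longrightarrow> dist (\<alpha> h x) (\<alpha> h y) < \<tau>"
proof -
  have "\<forall>h\<in>E. \<exists>\<delta>>0. \<forall>x\<in>X. \<forall>y\<in>X. dist x y < \<delta> \<longrightarrow> dist (\<alpha> h x) (\<alpha> h y) < \<tau>"
  proof
    fix h assume "h \<in> E"
    then have "uniformly_continuous_on X (\<alpha> h)"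
      using assms compact_space continuous_act by (intro compact_uniformly_continuous) auto
    then show "\<exists>\<delta>>0. \<forall>x\<in>X. \<forall>y\<in>X. dist x y < \<delta> \<longrightarrow> dist (\<alpha> h x) (\<alpha> h y) < \<tau>"
      using \<open>0 < \<tau>\<close> unfolding uniformly_continuous_on_def by (metis dist_commute)
  qed
  then obtain D where D: "\<And>h. h \<in> E \<Longrightarrow> D h > (0::real)"
    "\<And>h x y. h \<in> E \<Longrightarrow> x \<in> X \<Longrightarrow> y \<in> X \<Longrightarrow> dist x y < D h \<Longrightarrow> dist (\<alpha> h x) (\<alpha> h y) < \<tau>"
    by metis
  define \<delta> where "\<delta> = Min (insert 1 (D ` E))"
  have "0 < \<delta>" using D(1) \<open>finite E\<close> by (auto simp: \<delta>_def)
  moreover have "\<delta> \<le> D h" if "h \<in> E" for h using that \<open>finite E\<close> by (auto simp: \<delta>_def)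
  ultimately show ?thesis using D(2) that by (meson less_le_trans)
qed

text \<open>
  By compactness of \<open>{(x, y). dist x y \<ge> \<eta>}\<close>, finitely many group elements suffice to tell apart all
  pairs of points at distance at least \<open>\<eta>\<close>.
\<close>

lemma expansive_finite_window:
  assumes exp: "\<And>x y. x \<in> X \<Longrightarrow> y \<in> X \<Longrightarrow> x \<noteq> y \<Longrightarrow> \<exists>g\<in>carrier G. c < dist (\<alpha> g x) (\<alpha> g y)"
    and "0 < \<eta>"
  obtains D where "finite D" and "D \<subseteq> carrier G"
    and "\<And>x y. x \<in> X \<Longrightarrow> y \<in> X \<Longrightarrow> (\<And>h. h \<in> D \<Longrightarrow> dist (\<alpha> h x) (\<alpha> h y) \<le> c) \<Longrightarrow> dist x y < \<eta>"
proof -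
  define Z where "Z = {p \<in> X \<times> X. \<eta> \<le> dist (fst p) (snd p)}"
  define A where "A g = {p \<in> Z. dist (\<alpha> g (fst p)) (\<alpha> g (snd p)) \<le> c}" for g
  have "closed (X \<times> X)" using compact_space compact_Times compact_imp_closed by blast
  have "closed Z"
    unfolding Z_def by (intro continuous_on_closed_Collect_le \<open>closed (X \<times> X)\<close> continuous_intros)
  have "Z \<subseteq> X \<times> X" by (auto simp: Z_def)
  have "compact ((X \<times> X) \<inter> Z)"
    by (intro compact_Int_closed compact_Times compact_space \<open>closed Z\<close>)
  then have "compact Z" using \<open>Z \<subseteq> X \<times> X\<close> by (simp add: Int_absorb1)
  have closedA: "closed (A g)" if g: "g \<in> carrier G" for g
  proof -
    have "continuous_on Z (\<lambda>p. \<alpha> g (fst p))" "continuous_on Z (\<lambda>p. \<alpha> g (snd p))"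
      using \<open>Z \<subseteq> X \<times> X\<close>
      by (auto intro!: continuous_on_compose2[OF continuous_act[OF g]] continuous_intros)
    then show ?thesis
      unfolding A_def by (intro continuous_on_closed_Collect_le \<open>closed Z\<close> continuous_intros)
  qed
  have "\<exists>D. finite D \<and> D \<subseteq> carrier G \<and> Z \<inter> (\<Inter>g\<in>D. A g) = {}"
  proof (rule ccontr)
    assume "\<not> ?thesis"
    then have fip: "Z \<inter> (\<Inter>g\<in>D. A g) \<noteq> {}" if "finite D" "D \<subseteq> carrier G" for D
      using that by blast
    have "Z \<inter> (\<Inter>g\<in>carrier G. A g) \<noteq> {}"
      by (rule compact_imp_fip_image[OF \<open>compact Z\<close> closedA fip])
    then obtain x y where xy: "(x, y) \<in> Z" "\<And>g. g \<in> carrier G \<Longrightarrow> (x, y) \<in> A g" by auto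
    then have "x \<in> X" "y \<in> X" "x \<noteq> y" using \<open>0 < \<eta>\<close> by (auto simp: Z_def)
    then show False using exp[of x y] xy(2) by (force simp: A_def)
  qed
  then obtain D where D: "finite D" "D \<subseteq> carrier G" "Z \<inter> (\<Inter>g\<in>D. A g) = {}" by blast
  show ?thesis
  proof (rule that[OF D(1,2)])
    fix x y assume xy: "x \<in> X" "y \<in> X" "\<And>h. h \<in> D \<Longrightarrow> dist (\<alpha> h x) (\<alpha> h y) \<le> c"
    show "dist x y < \<eta>"
    proof (rule ccontr)
      assume "\<not> dist x y < \<eta>"
      then have "(x, y) \<in> Z" using xy by (auto simp: Z_def)
      then have "(x, y) \<in> Z \<inter> (\<Inter>g\<in>D. A g)" using xy by (auto simp: A_def)
      then show False using D by blast
    qed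
  qed
qed

text \<open>Numbering a finite family reduces it to the families indexed by natural numbers.\<close>

lemma weak_specificationE:
  assumes "weak_specification G X \<alpha>" and "0 < \<epsilon>"
  obtains F where "finite F" and "F \<subseteq> carrier G" and "\<one> \<in> F" and "\<And>s. s \<in> F \<Longrightarrow> inv s \<in> F"
    and "\<And>(I :: 'i set) \<Omega> x. finite I \<Longrightarrow> (\<And>i. i \<in> I \<Longrightarrow> finite (\<Omega> i) \<and> \<Omega> i \<subseteq> carrier G) \<Longrightarrow>
           (\<And>i j. i \<in> I \<Longrightarrow> j \<in> I \<Longrightarrow> i \<noteq> j \<Longrightarrow> (F <#> \<Omega> i) \<inter> \<Omega> j = {}) \<Longrightarrow>
           (\<And>i. i \<in> I \<Longrightarrow> x i \<in> X) \<Longrightarrow>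
           (\<exists>z\<in>X. \<forall>i\<in>I. \<forall>s\<in>\<Omega> i. dist (\<alpha> s z) (\<alpha> s (x i)) \<le> \<epsilon>)"
proof -
  obtain F where F: "finite F" "F \<subseteq> carrier G" "\<one> \<in> F" "\<forall>s\<in>F. inv s \<in> F"
    and spec: "\<forall>(I :: nat set) \<Omega> x. finite I \<longrightarrow>
           (\<forall>i\<in>I. finite (\<Omega> i) \<and> \<Omega> i \<subseteq> carrier G) \<longrightarrow>
           (\<forall>i\<in>I. \<forall>j\<in>I. i \<noteq> j \<longrightarrow> (F <#> \<Omega> i) \<inter> \<Omega> j = {}) \<longrightarrow> (\<forall>i\<in>I. x i \<in> X) \<longrightarrow>
           (\<exists>z\<in>X. \<forall>i\<in>I. \<forall>s\<in>\<Omega> i. dist (\<alpha> s z) (\<alpha> s (x i)) \<le> \<epsilon>)"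
    using assms(1)[unfolded weak_specification_def, THEN spec, THEN mp, OF assms(2)]
    by (elim exE conjE) (rule that)
  show ?thesis
  proof (rule that[of F])
    fix I :: "'i set" and \<Omega> x
    assume I: "finite I" "\<And>i. i \<in> I \<Longrightarrow> finite (\<Omega> i) \<and> \<Omega> i \<subseteq> carrier G"
      "\<And>i j. i \<in> I \<Longrightarrow> j \<in> I \<Longrightarrow> i \<noteq> j \<Longrightarrow> (F <#> \<Omega> i) \<inter> \<Omega> j = {}" "\<And>i. i \<in> I \<Longrightarrow> x i \<in> X"
    obtain b where b: "bij_betw b {0..<card I} I" using ex_bij_betw_nat_finite[OF I(1)] by blast
    have bI: "\<And>n. n < card I \<Longrightarrow> b n \<in> I" using b by (auto simp: bij_betw_def)
    have bne: "\<And>n m. n < card I \<Longrightarrow> m < card I \<Longrightarrow> n \<noteq> m \<Longrightarrow> b n \<noteq> b m"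
      using b by (auto simp: bij_betw_def inj_on_def)
    have "\<exists>z\<in>X. \<forall>n\<in>{0..<card I}. \<forall>s\<in>\<Omega> (b n). dist (\<alpha> s z) (\<alpha> s (x (b n))) \<le> \<epsilon>"
      using spec[rule_format, of "{0..<card I}" "\<lambda>n. \<Omega> (b n)" "\<lambda>n. x (b n)"] I bI bne by simp
    moreover have "I = b ` {0..<card I}" using b by (simp add: bij_betw_def)
    ultimately show "\<exists>z\<in>X. \<forall>i\<in>I. \<forall>s\<in>\<Omega> i. dist (\<alpha> s z) (\<alpha> s (x i)) \<le> \<epsilon>" by (metis (no_types, lifting) imageE)
  qed (use F in auto)
qed

lemma set_multI: "a \<in> A \<Longrightarrow> b \<in> B \<Longrightarrow> a \<otimes> b \<in> A <#> B"
  unfolding set_mult_def by blast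

lemma set_multE: "c \<in> A <#> B \<Longrightarrow> (\<And>a b. a \<in> A \<Longrightarrow> b \<in> B \<Longrightarrow> c = a \<otimes> b \<Longrightarrow> P) \<Longrightarrow> P"
  unfolding set_mult_def by blast

lemma finite_set_mult: "finite A \<Longrightarrow> finite B \<Longrightarrow> finite (A <#> B)"
  unfolding set_mult_def by auto

end

text \<open>
  The data for changing a point near finitely many places of its orbit.  At each place \<open>s\<close> of a
  \<open>K\<close>-separated set \<open>A\<close>, the orbit of \<open>y\<close> is replaced along \<open>F0 s\<close> by the orbit of the transplant
  \<open>\<zeta> (w s)\<close>, and it is changed by at most \<open>\<epsilon>\<close> everywhere else.  The transplant is computed from a point
  \<open>w s\<close> that is merely close to \<open>\<alpha> s y\<close>, so that different points which see the same place can use the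
  same transplant.
\<close>

locale replacement = compact_action G X \<alpha>
  for G :: "('a, 'm) monoid_scheme" (structure) and X :: "'b::metric_space set"
    and \<alpha> :: "'a \<Rightarrow> 'b \<Rightarrow> 'b" +
  fixes x0 :: 'b and \<epsilon> \<tau> :: real and F0 M K :: "'a set" and \<zeta> :: "'b \<Rightarrow> 'b"
  assumes finite_sets: "finite F0" "finite M" "finite K"
    and subsets: "F0 \<subseteq> carrier G" "M \<subseteq> carrier G" "K \<subseteq> carrier G" "F0 \<subseteq> K"
    and F0_symmetric: "\<one> \<in> F0" "\<And>s. s \<in> F0 \<Longrightarrow> inv s \<in> F0"
    and pos: "0 < \<epsilon>" "0 < \<tau>"
    and transplant_near: "\<And>y. y \<in> X \<Longrightarrow> dist (\<zeta> y) x0 \<le> \<epsilon>"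
    and transplant_closed: "\<And>y. y \<in> X \<Longrightarrow> \<zeta> y \<in> X"
    and replace: "\<And>A y w. finite A \<Longrightarrow> A \<subseteq> carrier G \<Longrightarrow> y \<in> X \<Longrightarrow>
           (\<And>s t. s \<in> A \<Longrightarrow> t \<in> A \<Longrightarrow> s \<noteq> t \<Longrightarrow> t \<otimes> inv s \<notin> K) \<Longrightarrow>
           (\<And>s. s \<in> A \<Longrightarrow> w s \<in> X) \<Longrightarrow>
           (\<And>s t. s \<in> A \<Longrightarrow> t \<in> M \<Longrightarrow> dist (\<alpha> t (\<alpha> s y)) (\<alpha> t (w s)) \<le> \<tau>) \<Longrightarrow>
           \<exists>z\<in>X. (\<forall>s\<in>A. \<forall>t\<in>F0. dist (\<alpha> t (\<alpha> s z)) (\<alpha> t (\<zeta> (w s))) \<le> 2 * \<epsilon>) \<and>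
                 (\<forall>g\<in>carrier G - (F0 <#> A). dist (\<alpha> g z) (\<alpha> g y) \<le> \<epsilon>)"

context compact_action
begin

text \<open>
  Weak specification provides a transplant \<open>\<zeta> y\<close> that is close to \<open>x0\<close> at the identity and shadows \<open>y\<close>
  on the annulus \<open>F F0 - F0\<close>, and then a point that shadows \<open>\<zeta> (w s)\<close> near every \<open>s \<in> A\<close>.  On the
  boundary of \<open>F0 A\<close> this point is close to \<open>y\<close>, so the Markov property glues it to \<open>y\<close> without
  spoiling anything outside \<open>F0 A\<close>.  All places are treated in one step, hence the errors do not grow
  with \<open>A\<close> and the separation \<open>K\<close> depends on \<open>\<epsilon>\<close> alone.
\<close>

lemma local_replacement:
  assumes ws: "weak_specification G X \<alpha>" and stm: "strong_topological_Markov G X \<alpha>"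
    and x0: "x0 \<in> X" and "0 < \<epsilon>"
  obtains \<tau> F0 M K \<zeta> where "replacement G X \<alpha> x0 \<epsilon> \<tau> F0 M K \<zeta>"
proof -
  obtain \<delta> F where "0 < \<delta>" and F: "finite F" "F \<subseteq> carrier G" "\<one> \<in> F"
    and markov: "\<And>A x y. finite A \<Longrightarrow> A \<subseteq> carrier G \<Longrightarrow> x \<in> X \<Longrightarrow> y \<in> X \<Longrightarrow>
        (\<And>s. s \<in> (F <#> A) - A \<Longrightarrow> dist (\<alpha> s x) (\<alpha> s y) \<le> \<delta>) \<Longrightarrow>
        \<exists>z\<in>X. (\<forall>s\<in>F <#> A. dist (\<alpha> s z) (\<alpha> s x) \<le> \<epsilon>) \<and> (\<forall>s\<in>carrier G - A. dist (\<alpha> s z) (\<alpha> s y) \<le> \<epsilon>)"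
    using stm \<open>0 < \<epsilon>\<close> unfolding strong_topological_Markov_def by (metis (no_types, lifting))
  define \<tau> where "\<tau> = min \<epsilon> (\<delta> / 3)"
  have "0 < \<tau>" "\<tau> \<le> \<epsilon>" "3 * \<tau> \<le> \<delta>" using \<open>0 < \<delta>\<close> \<open>0 < \<epsilon>\<close> by (auto simp: \<tau>_def min_def)
  (* indices of option type, since two of them are needed even for the trivial group *)
  obtain F0 where F0: "finite F0" "F0 \<subseteq> carrier G" "\<one> \<in> F0" "\<And>s. s \<in> F0 \<Longrightarrow> inv s \<in> F0"
    and spec_opt: "\<And>(I :: 'g option set) \<Omega> x. finite I \<Longrightarrow> (\<And>i. i \<in> I \<Longrightarrow> finite (\<Omega> i) \<and> \<Omega> i \<subseteq> carrier G) \<Longrightarrow>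
           (\<And>i j. i \<in> I \<Longrightarrow> j \<in> I \<Longrightarrow> i \<noteq> j \<Longrightarrow> (F0 <#> \<Omega> i) \<inter> \<Omega> j = {}) \<Longrightarrow>
           (\<And>i. i \<in> I \<Longrightarrow> x i \<in> X) \<Longrightarrow>
           (\<exists>z\<in>X. \<forall>i\<in>I. \<forall>s\<in>\<Omega> i. dist (\<alpha> s z) (\<alpha> s (x i)) \<le> \<tau>)"
    by (rule weak_specificationE[OF ws \<open>0 < \<tau>\<close>, where 'i = "'g option"]) blast
  have spec: "\<exists>z\<in>X. \<forall>i\<in>I. \<forall>s\<in>\<Omega> i. dist (\<alpha> s z) (\<alpha> s (x i)) \<le> \<tau>"
    if "finite I" "\<And>i. i \<in> I \<Longrightarrow> finite (\<Omega> i) \<and> \<Omega> i \<subseteq> carrier G"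
      "\<And>i j. i \<in> I \<Longrightarrow> j \<in> I \<Longrightarrow> i \<noteq> j \<Longrightarrow> (F0 <#> \<Omega> i) \<inter> \<Omega> j = {}" "\<And>i. i \<in> I \<Longrightarrow> x i \<in> X"
    for I :: "'g set" and \<Omega> x
  proof -
    have fin: "finite (\<Omega> (the i)) \<and> \<Omega> (the i) \<subseteq> carrier G" if "i \<in> Some ` I" for i
      using that \<open>\<And>i. i \<in> I \<Longrightarrow> finite (\<Omega> i) \<and> \<Omega> i \<subseteq> carrier G\<close>[of "the i"] by auto
    have "\<exists>z\<in>X. \<forall>i\<in>Some ` I. \<forall>s\<in>\<Omega> (the i). dist (\<alpha> s z) (\<alpha> s (x (the i))) \<le> \<tau>"
    proof (rule spec_opt[OF _ fin])
      show "(F0 <#> \<Omega> (the i)) \<inter> \<Omega> (the j) = {}" if "i \<in> Some ` I" "j \<in> Some ` I" "i \<noteq> j" for i j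
        using that \<open>\<And>i j. i \<in> I \<Longrightarrow> j \<in> I \<Longrightarrow> i \<noteq> j \<Longrightarrow> (F0 <#> \<Omega> i) \<inter> \<Omega> j = {}\<close>[of "the i" "the j"] by auto
    qed (use that in auto)
    then show ?thesis by simp
  qed
  have spec2: "\<exists>z\<in>X. (\<forall>s\<in>\<Omega>. dist (\<alpha> s z) (\<alpha> s x) \<le> \<tau>) \<and> (\<forall>s\<in>\<Omega>'. dist (\<alpha> s z) (\<alpha> s y) \<le> \<tau>)"
    if "finite \<Omega>" "\<Omega> \<subseteq> carrier G" "finite \<Omega>'" "\<Omega>' \<subseteq> carrier G" "x \<in> X" "y \<in> X"
      "(F0 <#> \<Omega>) \<inter> \<Omega>' = {}" "(F0 <#> \<Omega>') \<inter> \<Omega> = {}" for \<Omega> \<Omega>' x y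
  proof -
    have "\<exists>z\<in>X. \<forall>i\<in>{None, Some \<one>}. \<forall>s\<in>case_option \<Omega> (\<lambda>_. \<Omega>') i.
        dist (\<alpha> s z) (\<alpha> s (case_option x (\<lambda>_. y) i)) \<le> \<tau>"
      by (rule spec_opt) (use that in \<open>auto split: option.splits\<close>)
    then show ?thesis by auto
  qed
  define M where "M = F <#> F0"
  have M: "finite M" "M \<subseteq> carrier G" "F0 \<subseteq> M"
    using F F0 finite_set_mult set_mult_closed set_multI[OF F(3), where B = F0]
    by (auto simp: M_def) force
  have "\<exists>z. z \<in> X \<and> dist z x0 \<le> \<tau> \<and> (\<forall>t\<in>M - F0. dist (\<alpha> t z) (\<alpha> t y) \<le> \<tau>)" if y: "y \<in> X" for y
  proof -
    have "(F0 <#> {\<one>}) \<inter> (M - F0) = {}" using F0(2) by (auto elim!: set_multE)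
    moreover have "(F0 <#> (M - F0)) \<inter> {\<one>} = {}"
    proof -
      have False if "s \<in> F0" "t \<in> M - F0" "\<one> = s \<otimes> t" for s t
      proof -
        have "t = inv s" using that F0(2) M(2) inv_equality by (metis DiffD1 inv_inv inv_solve_left l_one r_one subsetD one_closed inv_closed)
        then show False using that F0(4) by blast
      qed
      then show ?thesis by (auto elim!: set_multE)
    qed
    ultimately obtain z where "z \<in> X" "dist (\<alpha> \<one> z) (\<alpha> \<one> x0) \<le> \<tau>"
      "\<forall>t\<in>M - F0. dist (\<alpha> t z) (\<alpha> t y) \<le> \<tau>"
      using spec2[of "{\<one>}" "M - F0" x0 y] M x0 y by auto
    then show ?thesis using x0 by auto
  qed
  then obtain \<zeta> where \<zeta>: "\<And>y. y \<in> X \<Longrightarrow> \<zeta> y \<in> X" "\<And>y. y \<in> X \<Longrightarrow> dist (\<zeta> y) x0 \<le> \<tau>"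
    "\<And>y t. y \<in> X \<Longrightarrow> t \<in> M - F0 \<Longrightarrow> dist (\<alpha> t (\<zeta> y)) (\<alpha> t y) \<le> \<tau>" by metis
  (* two places s, t whose neighbourhoods F0 M s and M t meet satisfy t s^-1 \<in> M^-1 F0 M *)
  define K where "K = F0 \<union> (m_inv G ` M <#> (F0 <#> M))"
  have K: "finite K" "K \<subseteq> carrier G" "F0 \<subseteq> K"
    using F0 M unfolding K_def by (auto simp: subset_iff intro!: finite_set_mult elim!: set_multE)
  show ?thesis
  proof (rule that[of \<tau> F0 M K \<zeta>], unfold_locales)
    show "\<zeta> y \<in> X" if "y \<in> X" for y using \<zeta>(1)[OF that] .
    show "dist (\<zeta> y) x0 \<le> \<epsilon>" if "y \<in> X" for y using \<zeta>(2)[OF that] \<open>\<tau> \<le> \<epsilon>\<close> by simp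
    fix A y w
    assume A: "finite A" "A \<subseteq> carrier G" and y: "y \<in> X"
      and Ksep: "\<And>s t. s \<in> A \<Longrightarrow> t \<in> A \<Longrightarrow> s \<noteq> t \<Longrightarrow> t \<otimes> inv s \<notin> K"
      and w: "\<And>s. s \<in> A \<Longrightarrow> w s \<in> X"
      and close: "\<And>s t. s \<in> A \<Longrightarrow> t \<in> M \<Longrightarrow> dist (\<alpha> t (\<alpha> s y)) (\<alpha> t (w s)) \<le> \<tau>"
    have "\<exists>x\<in>X. \<forall>s\<in>A. \<forall>g\<in>M <#> {s}. dist (\<alpha> g x) (\<alpha> g (\<alpha> (inv s) (\<zeta> (w s)))) \<le> \<tau>"
    proof (rule spec)
      show "finite (M <#> {s}) \<and> M <#> {s} \<subseteq> carrier G" if "s \<in> A" for s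
        using M A that by (auto intro!: finite_set_mult elim!: set_multE)
      show "\<alpha> (inv s) (\<zeta> (w s)) \<in> X" if "s \<in> A" for s using that A w \<zeta> by auto
      show "(F0 <#> (M <#> {s})) \<inter> (M <#> {t}) = {}" if st: "s \<in> A" "t \<in> A" "s \<noteq> t" for s t
      proof -
        have False if h: "f \<in> F0" "m \<in> M" "m' \<in> M" "f \<otimes> (m \<otimes> s) = m' \<otimes> t" for f m m'
        proof -
          have c: "f \<in> carrier G" "m \<in> carrier G" "m' \<in> carrier G" "s \<in> carrier G" "t \<in> carrier G"
            using h st A F0 M by auto
          have "t \<otimes> inv s = inv m' \<otimes> (f \<otimes> m)"
            using c h(4) by (metis inv_closed inv_solve_left inv_solve_right m_assoc m_closed)
          also have "\<dots> \<in> K" unfolding K_def using h by (auto intro!: set_multI)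
          finally show False using Ksep[OF st] by blast
        qed
        then show ?thesis by (auto elim!: set_multE)
      qed
    qed fact
    then obtain x where x: "x \<in> X"
      and xs: "\<And>s g. s \<in> A \<Longrightarrow> g \<in> M <#> {s} \<Longrightarrow> dist (\<alpha> g x) (\<alpha> g (\<alpha> (inv s) (\<zeta> (w s)))) \<le> \<tau>"
      by blast
    have x_near: "dist (\<alpha> (t \<otimes> s) x) (\<alpha> t (\<zeta> (w s))) \<le> \<tau>" if "s \<in> A" "t \<in> M" for s t
    proof -
      have c: "s \<in> carrier G" "t \<in> carrier G" using that A M by auto
      have "\<alpha> (t \<otimes> s) (\<alpha> (inv s) (\<zeta> (w s))) = \<alpha> t (\<zeta> (w s))"
        using c \<zeta>(1)[OF w[OF that(1)]] by (simp add: act_act m_assoc)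
      then show ?thesis using xs[OF that(1), of "t \<otimes> s"] that(2) by (simp add: set_multI)
    qed
    have F0A: "finite (F0 <#> A)" "F0 <#> A \<subseteq> carrier G"
      using F0 A by (auto intro!: finite_set_mult elim!: set_multE)
    have FF0A: "t \<otimes> s \<in> F <#> (F0 <#> A)" if ts: "t \<in> M" "s \<in> A" for t s
    proof -
      obtain f f0 where "f \<in> F" "f0 \<in> F0" "t = f \<otimes> f0" using ts(1) unfolding M_def by (rule set_multE)
      then show ?thesis using F F0 A ts by (auto simp: m_assoc subset_iff intro!: set_multI)
    qed
    have FF0A': "\<exists>t\<in>M. \<exists>s\<in>A. g = t \<otimes> s" if g: "g \<in> F <#> (F0 <#> A)" for g
    proof -
      obtain f f0 s where "f \<in> F" "f0 \<in> F0" "s \<in> A" "g = f \<otimes> (f0 \<otimes> s)" using g unfolding set_mult_def by blast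
      then show ?thesis using F F0 A by (intro bexI[of _ "f \<otimes> f0"] bexI[of _ s]) (auto simp: m_assoc subset_iff M_def intro!: set_multI)
    qed
    have "\<exists>z\<in>X. (\<forall>g\<in>F <#> (F0 <#> A). dist (\<alpha> g z) (\<alpha> g x) \<le> \<epsilon>) \<and>
        (\<forall>g\<in>carrier G - (F0 <#> A). dist (\<alpha> g z) (\<alpha> g y) \<le> \<epsilon>)"
    proof (rule markov[OF F0A x y])
      fix g assume g: "g \<in> (F <#> (F0 <#> A)) - (F0 <#> A)"
      obtain t s where ts: "t \<in> M" "s \<in> A" "g = t \<otimes> s" using FF0A'[OF DiffD1[OF g]] by blast
      then have "t \<in> M - F0" using g set_multI by blast
      have "\<alpha> g y = \<alpha> t (\<alpha> s y)" using ts A M y by (auto simp: act_act subset_iff)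
      then show "dist (\<alpha> g x) (\<alpha> g y) \<le> \<delta>"
        using x_near[OF ts(2,1)] \<zeta>(3)[OF w[OF ts(2)] \<open>t \<in> M - F0\<close>] close[OF ts(2,1)] \<open>3 * \<tau> \<le> \<delta>\<close> ts(3)
          dist_triangle[of "\<alpha> g x" "\<alpha> g y" "\<alpha> t (\<zeta> (w s))"]
          dist_triangle[of "\<alpha> t (\<zeta> (w s))" "\<alpha> g y" "\<alpha> t (w s)"]
        by (simp add: dist_commute)
    qed
    then obtain z where z: "z \<in> X" "\<And>g. g \<in> F <#> (F0 <#> A) \<Longrightarrow> dist (\<alpha> g z) (\<alpha> g x) \<le> \<epsilon>"
      "\<And>g. g \<in> carrier G - (F0 <#> A) \<Longrightarrow> dist (\<alpha> g z) (\<alpha> g y) \<le> \<epsilon>" by blast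
    have "dist (\<alpha> t (\<alpha> s z)) (\<alpha> t (\<zeta> (w s))) \<le> 2 * \<epsilon>" if st: "s \<in> A" "t \<in> F0" for s t
    proof -
      have "t \<in> M" using st M by blast
      have "\<alpha> (t \<otimes> s) z = \<alpha> t (\<alpha> s z)" using st A F0 z by (auto simp: act_act subset_iff)
      then show ?thesis
        using z(2)[OF FF0A[OF \<open>t \<in> M\<close> st(1)]] x_near[OF st(1) \<open>t \<in> M\<close>] \<open>\<tau> \<le> \<epsilon>\<close>
          dist_triangle[of "\<alpha> t (\<alpha> s z)" "\<alpha> t (\<zeta> (w s))" "\<alpha> (t \<otimes> s) x"]
        by simp
    qed
    then show "\<exists>z\<in>X. (\<forall>s\<in>A. \<forall>t\<in>F0. dist (\<alpha> t (\<alpha> s z)) (\<alpha> t (\<zeta> (w s))) \<le> 2 * \<epsilon>) \<and>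
        (\<forall>g\<in>carrier G - (F0 <#> A). dist (\<alpha> g z) (\<alpha> g y) \<le> \<epsilon>)"
      using z by blast
  qed (use F0 M K \<open>0 < \<tau>\<close> \<open>0 < \<epsilon>\<close> in auto)
qed

end

section \<open>Sofic approximations\<close>

definition sparse_sets :: "(nat \<Rightarrow> nat) \<Rightarrow> (nat \<Rightarrow> nat set) \<Rightarrow> bool" where
  "sparse_sets d A \<longleftrightarrow> (\<lambda>j. real (card (A j)) / real (d j)) \<longlonglongrightarrow> 0"

lemma sparse_sets_subset_UN:
  assumes "finite I" and sparse: "\<And>i. i \<in> I \<Longrightarrow> sparse_sets d (A i)"
    and fin: "\<And>i j. i \<in> I \<Longrightarrow> finite (A i j)" and sub: "\<And>j. B j \<subseteq> (\<Union>i\<in>I. A i j)"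
  shows "sparse_sets d B"
  unfolding sparse_sets_def
proof (rule tendsto_sandwich[of "\<lambda>_. 0" _ _ "\<lambda>j. \<Sum>i\<in>I. real (card (A i j)) / real (d j)"])
  show "(\<lambda>j. \<Sum>i\<in>I. real (card (A i j)) / real (d j)) \<longlonglongrightarrow> 0"
    using sparse unfolding sparse_sets_def by (intro tendsto_null_sum) auto
  have "real (card (B j)) / real (d j) \<le> (\<Sum>i\<in>I. real (card (A i j)) / real (d j))" for j
  proof -
    have "card (B j) \<le> card (\<Union>i\<in>I. A i j)" using \<open>finite I\<close> fin by (intro card_mono sub) auto
    also have "\<dots> \<le> (\<Sum>i\<in>I. card (A i j))" by (rule card_UN_le[OF \<open>finite I\<close>])
    finally have "real (card (B j)) \<le> (\<Sum>i\<in>I. real (card (A i j)))"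
      by (metis of_nat_le_iff of_nat_sum)
    then show ?thesis by (simp add: sum_divide_distrib[symmetric] divide_right_mono)
  qed
  then show "\<forall>\<^sub>F j in sequentially. real (card (B j)) / real (d j) \<le> (\<Sum>i\<in>I. real (card (A i j)) / real (d j))"
    by simp
  show "\<forall>\<^sub>F j in sequentially. 0 \<le> real (card (B j)) / real (d j)" by simp
qed simp

lemma sparse_sets_eventually:
  assumes "sparse_sets d A" and "\<And>j. 0 < d j" and "0 < \<kappa>"
  shows "\<forall>\<^sub>F j in sequentially. real (card (A j)) \<le> \<kappa> * real (d j)"
proof -
  have "\<forall>\<^sub>F j in sequentially. real (card (A j)) / real (d j) < \<kappa>"
    using assms(1,3) unfolding sparse_sets_def by (rule order_tendstoD)
  then show ?thesis
  proof (rule eventually_mono)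
    fix j assume "real (card (A j)) / real (d j) < \<kappa>"
    then show "real (card (A j)) \<le> \<kappa> * real (d j)"
      using assms(2)[of j] by (simp add: pos_divide_less_eq)
  qed
qed

lemma sofic_permutes:
  assumes "sofic_approximation G d \<sigma>" and "s \<in> carrier G"
  shows "\<sigma> j s permutes {1..d j}"
  using assms by (simp add: sofic_approximation_def sym_group_carrier)

lemma sofic_dim_pos: "sofic_approximation G d \<sigma> \<Longrightarrow> 0 < d j"
  by (simp add: sofic_approximation_def)

lemma sofic_mult_defect_sparse:
  fixes G (structure)
  assumes sof: "sofic_approximation G d \<sigma>" and E: "finite E" "E \<subseteq> carrier G"
  shows "sparse_sets d (\<lambda>j. {a \<in> {1..d j}. \<exists>s\<in>E. \<exists>t\<in>E. \<sigma> j s (\<sigma> j t a) \<noteq> \<sigma> j (s \<otimes> t) a})"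
proof (rule sparse_sets_subset_UN)
  show "finite (E \<times> E)" using E by simp
  show "sparse_sets d (case i of (s, t) \<Rightarrow> \<lambda>j. {a \<in> {1..d j}. \<sigma> j s (\<sigma> j t a) \<noteq> \<sigma> j (s \<otimes> t) a})"
    if "i \<in> E \<times> E" for i
    using that E(2) sof
    by (auto simp: sparse_sets_def sofic_approximation_def hamming_dist_def sym_group_mult subset_iff)
qed (auto split: prod.splits)

text \<open>
  For \<open>k \<noteq> \<one>\<close> the permutations \<open>\<sigma> k\<close> and \<open>\<sigma> \<one>\<close> differ almost everywhere, and \<open>\<sigma> \<one>\<close> is close to the
  identity because it is injective and almost equal to its own square.
\<close>

lemma sofic_fixed_points_sparse:
  fixes G (structure)
  assumes sof: "sofic_approximation G d \<sigma>" and "group G"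
    and K: "finite K" "K \<subseteq> carrier G" "\<one> \<notin> K"
  shows "sparse_sets d (\<lambda>j. {a \<in> {1..d j}. \<exists>k\<in>K. \<sigma> j k a = a})"
proof -
  interpret group G by fact
  have moved: "sparse_sets d (\<lambda>j. {a \<in> {1..d j}. \<sigma> j \<one> a \<noteq> a})"
  proof -
    have "\<sigma> j \<one> (\<sigma> j \<one> a) = \<sigma> j \<one> a \<longleftrightarrow> \<sigma> j \<one> a = a" for j a
      using permutes_inj[OF sofic_permutes[OF sof one_closed, of j]] by (rule inj_eq)
    then show ?thesis
      using sofic_mult_defect_sparse[OF sof, of "{\<one>}"] by simp
  qed
  have agree: "sparse_sets d (\<lambda>j. {a \<in> {1..d j}. \<sigma> j k a = \<sigma> j \<one> a})" if k: "k \<in> K" for k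
  proof -
    have "k \<in> carrier G" "k \<noteq> \<one>" using k K by auto
    then have "(\<lambda>j. hamming_dist (d j) (\<sigma> j k) (\<sigma> j \<one>)) \<longlonglongrightarrow> 1"
      using sof by (simp add: sofic_approximation_def)
    then have "(\<lambda>j. 1 - hamming_dist (d j) (\<sigma> j k) (\<sigma> j \<one>)) \<longlonglongrightarrow> 1 - 1"
      by (intro tendsto_diff tendsto_const)
    moreover have "1 - hamming_dist (d j) (\<sigma> j k) (\<sigma> j \<one>)
        = real (card {a \<in> {1..d j}. \<sigma> j k a = \<sigma> j \<one> a}) / real (d j)" for j
    proof -
      have "card {a \<in> {1..d j}. \<sigma> j k a = \<sigma> j \<one> a} + card {a \<in> {1..d j}. \<sigma> j k a \<noteq> \<sigma> j \<one> a}
          = card ({a \<in> {1..d j}. \<sigma> j k a = \<sigma> j \<one> a} \<union> {a \<in> {1..d j}. \<sigma> j k a \<noteq> \<sigma> j \<one> a})"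
        by (rule card_Un_disjoint[symmetric]) auto
      also have "{a \<in> {1..d j}. \<sigma> j k a = \<sigma> j \<one> a} \<union> {a \<in> {1..d j}. \<sigma> j k a \<noteq> \<sigma> j \<one> a} = {1..d j}"
        by auto
      finally have "real (card {a \<in> {1..d j}. \<sigma> j k a = \<sigma> j \<one> a}) = real (d j) - real (card {a \<in> {1..d j}. \<sigma> j k a \<noteq> \<sigma> j \<one> a})"
        by simp
      then show ?thesis
        using sofic_dim_pos[OF sof, of j] by (simp add: hamming_dist_def field_simps)
    qed
    ultimately show ?thesis by (simp add: sparse_sets_def)
  qed
  show ?thesis
    by (rule sparse_sets_subset_UN[of "insert None (Some ` K)" d
        "case_option (\<lambda>j. {a \<in> {1..d j}. \<sigma> j \<one> a \<noteq> a}) (\<lambda>k j. {a \<in> {1..d j}. \<sigma> j k a = \<sigma> j \<one> a})"])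
      (use K moved agree in \<open>auto split: option.splits\<close>)
qed

text \<open>Chebyshev's inequality for the uniform distribution on \<open>{1..n}\<close>.\<close>

lemma card_far_points_le:
  assumes "0 < n" and "0 < \<delta>0" and "rho2 n \<phi> \<psi> < \<delta>"
  shows "real (card {a \<in> {1..n}. \<delta>0 \<le> dist (\<phi> a) (\<psi> a)}) * \<delta>0\<^sup>2 \<le> real n * \<delta>\<^sup>2"
proof -
  let ?S = "{a \<in> {1..n}. \<delta>0 \<le> dist (\<phi> a) (\<psi> a)}" and ?T = "\<Sum>a\<in>{1..n}. (dist (\<phi> a) (\<psi> a))\<^sup>2"
  have "real (card ?S) * \<delta>0\<^sup>2 = (\<Sum>a\<in>?S. \<delta>0\<^sup>2)" by simp
  also have "\<dots> \<le> (\<Sum>a\<in>?S. (dist (\<phi> a) (\<psi> a))\<^sup>2)"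
    using assms by (intro sum_mono power_mono) auto
  also have "\<dots> \<le> ?T" by (rule sum_mono2) auto
  also have "\<dots> \<le> real n * \<delta>\<^sup>2"
  proof -
    have "?T / real n \<le> (sqrt (?T / real n))\<^sup>2" by (simp add: sum_nonneg)
    also have "\<dots> \<le> \<delta>\<^sup>2"
      using assms(3) unfolding rho2_def by (intro power_mono) (simp_all add: sum_nonneg)
    finally have "?T / real n \<le> \<delta>\<^sup>2" .
    then show ?thesis using assms by (simp add: field_simps)
  qed
  finally show ?thesis .
qed

context compact_action
begin

text \<open>
  The error is measured after the elements of \<open>E\<close> have acted, because maps are compared along finite
  pieces of orbits.
\<close>

definition good_points :: "'g set \<Rightarrow> real \<Rightarrow> nat \<Rightarrow> ('g \<Rightarrow> nat \<Rightarrow> nat) \<Rightarrow> (nat \<Rightarrow> 'a) \<Rightarrow> nat set" where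
  "good_points E \<tau> n p \<phi> =
     {a \<in> {1..n}. (\<forall>s\<in>E. \<forall>t\<in>E. p s (p t a) = p (s \<otimes> t) a) \<and>
        (\<forall>h\<in>E. \<forall>s\<in>E. dist (\<alpha> h (\<phi> (p s a))) (\<alpha> h (\<alpha> s (\<phi> a))) \<le> \<tau>)}"

text \<open>
  Uniform continuity replaces the bound along \<open>E\<close> by a bound \<open>\<delta>0\<close> on a single distance, and this one
  fails rarely when the mean square is small.
\<close>

lemma few_bad_points:
  assumes sof: "sofic_approximation G d \<sigma>" and E: "finite E" "E \<subseteq> carrier G"
    and "0 < \<tau>" and "0 < \<kappa>"
  obtains \<delta> where "0 < \<delta>"
    and "\<forall>\<^sub>F j in sequentially. \<forall>\<phi>\<in>Map_sofic \<alpha> X E \<delta> (d j) (\<sigma> j).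
           real (card ({1..d j} - good_points E \<tau> (d j) (\<sigma> j) \<phi>)) \<le> \<kappa> * real (d j)"
proof -
  obtain \<delta>0 where "0 < \<delta>0"
    and unif: "\<And>h x y. h \<in> E \<Longrightarrow> x \<in> X \<Longrightarrow> y \<in> X \<Longrightarrow> dist x y < \<delta>0 \<Longrightarrow> dist (\<alpha> h x) (\<alpha> h y) < \<tau>"
    using uniformly_continuous_finite[OF E \<open>0 < \<tau>\<close>] by blast
  define q where "q = \<kappa> / (2 * (real (card E) + 1))"
  define \<delta> where "\<delta> = \<delta>0 * sqrt q"
  have "0 < q" using \<open>0 < \<kappa>\<close> by (simp add: q_def)
  then have "0 < \<delta>" using \<open>0 < \<delta>0\<close> by (simp add: \<delta>_def)
  have "real (card E) * q \<le> (real (card E) + 1) * q" using \<open>0 < q\<close> by simp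
  also have "\<dots> = \<kappa> / 2" by (simp add: q_def field_simps)
  finally have Eq: "real (card E) * q \<le> \<kappa> / 2" .
  let ?D = "\<lambda>j. {a \<in> {1..d j}. \<exists>s\<in>E. \<exists>t\<in>E. \<sigma> j s (\<sigma> j t a) \<noteq> \<sigma> j (s \<otimes> t) a}"
  have ev: "\<forall>\<^sub>F j in sequentially. real (card (?D j)) \<le> \<kappa> / 2 * real (d j)"
    using sofic_mult_defect_sparse[OF sof E] sofic_dim_pos[OF sof] \<open>0 < \<kappa>\<close>
    by (intro sparse_sets_eventually) auto
  show ?thesis
  proof (rule that[OF \<open>0 < \<delta>\<close>], rule eventually_mono[OF ev], rule ballI)
    fix j \<phi> assume D: "real (card (?D j)) \<le> \<kappa> / 2 * real (d j)"
      and \<phi>: "\<phi> \<in> Map_sofic \<alpha> X E \<delta> (d j) (\<sigma> j)"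
    let ?far = "\<lambda>s. {a \<in> {1..d j}. \<delta>0 \<le> dist ((\<phi> \<circ> \<sigma> j s) a) (\<alpha> s (\<phi> a))}"
    have far: "real (card (?far s)) \<le> q * real (d j)" if s: "s \<in> E" for s
    proof -
      have "rho2 (d j) (\<phi> \<circ> \<sigma> j s) (\<lambda>a. \<alpha> s (\<phi> a)) < \<delta>" using \<phi> s by (simp add: Map_sofic_def)
      from card_far_points_le[OF sofic_dim_pos[OF sof] \<open>0 < \<delta>0\<close> this]
      have "real (card (?far s)) * \<delta>0\<^sup>2 \<le> (q * real (d j)) * \<delta>0\<^sup>2"
        using \<open>0 < q\<close> by (simp add: \<delta>_def power_mult_distrib algebra_simps)
      then show ?thesis using \<open>0 < \<delta>0\<close> by simp
    qed
    have "{1..d j} - good_points E \<tau> (d j) (\<sigma> j) \<phi> \<subseteq> ?D j \<union> (\<Union>s\<in>E. ?far s)"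
    proof
      fix a assume a: "a \<in> {1..d j} - good_points E \<tau> (d j) (\<sigma> j) \<phi>"
      show "a \<in> ?D j \<union> (\<Union>s\<in>E. ?far s)"
      proof (rule ccontr)
        assume not: "\<not> ?thesis"
        have "dist (\<alpha> h (\<phi> (\<sigma> j s a))) (\<alpha> h (\<alpha> s (\<phi> a))) \<le> \<tau>" if hs: "h \<in> E" "s \<in> E" for h s
        proof -
          have "\<sigma> j s a \<in> {1..d j}"
            using a hs E by (subst permutes_in_image[OF sofic_permutes[OF sof]]) auto
          then have "\<phi> (\<sigma> j s a) \<in> X" "\<phi> a \<in> X" using \<phi> a by (auto simp: Map_sofic_def)
          moreover have "dist (\<phi> (\<sigma> j s a)) (\<alpha> s (\<phi> a)) < \<delta>0" using not a hs by force
          ultimately show ?thesis using unif[OF hs(1)] hs E by (meson act_closed less_imp_le subsetD)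
        qed
        then show False using a not unfolding good_points_def by blast
      qed
    qed
    then have "card ({1..d j} - good_points E \<tau> (d j) (\<sigma> j) \<phi>) \<le> card (?D j \<union> (\<Union>s\<in>E. ?far s))"
      using E by (intro card_mono) auto
    also have "\<dots> \<le> card (?D j) + card (\<Union>s\<in>E. ?far s)" by (rule card_Un_le)
    also have "card (\<Union>s\<in>E. ?far s) \<le> (\<Sum>s\<in>E. card (?far s))" by (rule card_UN_le[OF E(1)])
    finally have "real (card ({1..d j} - good_points E \<tau> (d j) (\<sigma> j) \<phi>))
        \<le> real (card (?D j)) + (\<Sum>s\<in>E. real (card (?far s)))"
      by (simp only: of_nat_sum[symmetric] of_nat_add[symmetric] of_nat_le_iff add_le_cancel_left)
    also have "(\<Sum>s\<in>E. real (card (?far s))) \<le> (\<Sum>s\<in>E. q * real (d j))" by (rule sum_mono[OF far])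
    also have "\<dots> = real (card E) * q * real (d j)" by simp
    also have "\<dots> \<le> \<kappa> / 2 * real (d j)" using Eq by (intro mult_right_mono) auto
    finally show "real (card ({1..d j} - good_points E \<tau> (d j) (\<sigma> j) \<phi>)) \<le> \<kappa> * real (d j)"
      using D by simp
  qed
qed

end

section \<open>Surgery on sofic models\<close>

context replacement
begin

text \<open>
  Large enough to contain the shifted places that occur when the surroundings of \<open>a\<close> and of \<open>p g a\<close>,
  \<open>g \<in> F\<close>, are compared along \<open>D\<close>.
\<close>

definition window :: "'a set \<Rightarrow> 'a set \<Rightarrow> 'a set" where
  "window D F = F0 \<union> M \<union> K \<union> D \<union> F \<union> (F0 <#> D) \<union> (F0 <#> (D <#> F))"

lemma finite_window: "finite D \<Longrightarrow> finite F \<Longrightarrow> finite (window D F)"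
  unfolding window_def by (intro finite_UnI finite_set_mult finite_sets)

lemma window_subset: "D \<subseteq> carrier G \<Longrightarrow> F \<subseteq> carrier G \<Longrightarrow> window D F \<subseteq> carrier G"
  unfolding window_def by (intro Un_least set_mult_closed subsets)

text \<open>
  The new map sends a good point \<open>a\<close> to the point obtained by replacement at the finite set of
  \<open>s\<close> in the window for which \<open>p s a\<close> lies in \<open>W\<close>.  The transplant used at a place \<open>w \<in> W\<close> depends on
  \<open>w\<close> only, hence \<open>g\<close> applied to the value at \<open>a\<close> and the value at \<open>p g a\<close> stay within \<open>4 \<epsilon>\<close> of each
  other along \<open>D\<close>.  The choice of \<open>D\<close>, which expansiveness permits, turns this coarse bound into
  closeness within \<open>\<delta> / 2\<close>, so the separation needed of \<open>W\<close> does not depend on \<open>\<delta>\<close>.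
\<close>

lemma surgery:
  fixes p :: "'a \<Rightarrow> nat \<Rightarrow> nat" and \<phi> :: "nat \<Rightarrow> 'b"
  assumes "0 < n" and perm: "\<And>s. s \<in> carrier G \<Longrightarrow> p s permutes {1..n}"
    and V: "V \<subseteq> {1..n}" and Vindep: "\<And>k v. k \<in> K - {\<one>} \<Longrightarrow> v \<in> V \<Longrightarrow> p k v \<notin> V"
    and D: "finite D" "D \<subseteq> carrier G" and F: "finite F" "F \<subseteq> carrier G"
    and "0 < \<delta>" and window: "\<And>x y. x \<in> X \<Longrightarrow> y \<in> X \<Longrightarrow>
          (\<And>h. h \<in> D \<Longrightarrow> dist (\<alpha> h x) (\<alpha> h y) \<le> 4 * \<epsilon>) \<Longrightarrow> dist x y < \<delta> / 2"
    and \<phi>: "\<phi> \<in> {1..n} \<rightarrow>\<^sub>E X"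
    and W: "W \<subseteq> V \<inter> good_points (window D F) (min \<tau> \<epsilon>) n p \<phi>"
    and bad: "real (card ({1..n} - good_points (window D F) (min \<tau> \<epsilon>) n p \<phi>)) \<le> \<kappa> * real n"
    and diam: "\<And>x y. x \<in> X \<Longrightarrow> y \<in> X \<Longrightarrow> dist x y \<le> b" and \<kappa>: "2 * \<kappa> * b\<^sup>2 \<le> \<delta>\<^sup>2 / 4"
  obtains \<phi>' where "\<phi>' \<in> Map_sofic \<alpha> X F \<delta> n p"
    and "\<And>w. w \<in> W \<Longrightarrow> dist (\<phi>' w) x0 \<le> 3 * \<epsilon>"
    and "\<And>a. a \<in> {1..n} - (\<Union>t\<in>F0. p t ` W) \<Longrightarrow> dist (\<phi>' a) (\<phi> a) \<le> \<epsilon>"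
    and "\<And>v. v \<in> V - W \<Longrightarrow> dist (\<phi>' v) (\<phi> v) \<le> \<epsilon>"
proof -
  define E where "E = window D F"
  define good where "good = good_points E (min \<tau> \<epsilon>) n p \<phi>"
  have E: "finite E" "E \<subseteq> carrier G" using finite_window window_subset D F by (auto simp: E_def)
  have inE: "\<And>s. s \<in> F0 \<or> s \<in> M \<or> s \<in> K \<or> s \<in> D \<or> s \<in> F \<Longrightarrow> s \<in> E"
    "\<And>t h. t \<in> F0 \<Longrightarrow> h \<in> D \<Longrightarrow> t \<otimes> h \<in> E"
    "\<And>t h g. t \<in> F0 \<Longrightarrow> h \<in> D \<Longrightarrow> g \<in> F \<Longrightarrow> t \<otimes> (h \<otimes> g) \<in> E"
    unfolding E_def window_def by (auto intro: set_multI)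
  have "\<one> \<in> E" using inE F0_symmetric by blast
  have mult: "p s (p t a) = p (s \<otimes> t) a" if "a \<in> good" "s \<in> E" "t \<in> E" for a s t
    using that by (simp add: good_def good_points_def)
  have equiv: "dist (\<alpha> h (\<phi> (p s a))) (\<alpha> h (\<alpha> s (\<phi> a))) \<le> min \<tau> \<epsilon>" if "a \<in> good" "h \<in> E" "s \<in> E" for a h s
    using that by (simp add: good_def good_points_def)
  have good_sub: "good \<subseteq> {1..n}" by (auto simp: good_def good_points_def)
  have W: "W \<subseteq> V" "W \<subseteq> good" using W by (auto simp: good_def E_def)
  have range: "p s a \<in> {1..n}" if "s \<in> carrier G" "a \<in> {1..n}" for s a
    using that permutes_in_image[OF perm] by blast
  have val: "\<phi> a \<in> X" if "a \<in> {1..n}" for a using \<phi> that by blast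
  have p1: "p \<one> a = a" if "a \<in> good" for a
    using mult[OF that \<open>\<one> \<in> E\<close> \<open>\<one> \<in> E\<close>] permutes_inj[OF perm[OF one_closed]] by (simp add: inj_eq)
  define At where "At a = {s \<in> E. p s a \<in> W}" for a
  have At: "finite (At a)" "At a \<subseteq> carrier G" for a using E by (auto simp: At_def)
  have "\<exists>z\<in>X. (\<forall>s\<in>At a. \<forall>t\<in>F0. dist (\<alpha> t (\<alpha> s z)) (\<alpha> t (\<zeta> (\<phi> (p s a)))) \<le> 2 * \<epsilon>) \<and>
      (\<forall>g\<in>carrier G - (F0 <#> At a). dist (\<alpha> g z) (\<alpha> g (\<phi> a)) \<le> \<epsilon>)" if a: "a \<in> good" for a
  proof (rule replace[OF At])
    show "\<phi> a \<in> X" using a good_sub val by blast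
    show "\<phi> (p s a) \<in> X" if "s \<in> At a" for s using that a good_sub val range At by blast
    show "dist (\<alpha> t (\<alpha> s (\<phi> a))) (\<alpha> t (\<phi> (p s a))) \<le> \<tau>" if "s \<in> At a" "t \<in> M" for s t
      using equiv[OF a, of t s] that inE by (simp add: At_def dist_commute)
    show "t \<otimes> inv s \<notin> K" if st: "s \<in> At a" "t \<in> At a" "s \<noteq> t" for s t
    proof
      assume k: "t \<otimes> inv s \<in> K"
      have c: "s \<in> carrier G" "t \<in> carrier G" using st At by auto
      have "t \<otimes> inv s \<noteq> \<one>" using c st(3) by (metis inv_inv inv_closed inv_equality)
      moreover have "p (t \<otimes> inv s) (p s a) = p t a"
        using mult[OF a, of "t \<otimes> inv s" s] inE k st c by (simp add: At_def m_assoc)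
      moreover have "p s a \<in> V" "p t a \<in> V" using st W by (auto simp: At_def)
      ultimately show False using Vindep[of "t \<otimes> inv s" "p s a"] k by auto
    qed
  qed
  then obtain z where zX: "\<And>a. a \<in> good \<Longrightarrow> z a \<in> X"
    and z_in: "\<And>a s t. a \<in> good \<Longrightarrow> s \<in> At a \<Longrightarrow> t \<in> F0 \<Longrightarrow>
        dist (\<alpha> t (\<alpha> s (z a))) (\<alpha> t (\<zeta> (\<phi> (p s a)))) \<le> 2 * \<epsilon>"
    and z_out: "\<And>a g. a \<in> good \<Longrightarrow> g \<in> carrier G - (F0 <#> At a) \<Longrightarrow> dist (\<alpha> g (z a)) (\<alpha> g (\<phi> a)) \<le> \<epsilon>"
    by metis
  have equivariant: "dist (\<alpha> g (z a)) (z (p g a)) < \<delta> / 2"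
    if a: "a \<in> good" and b: "p g a \<in> good" and g: "g \<in> F" for a g
  proof (rule window)
    have gc: "g \<in> carrier G" "g \<in> E" using g F inE by auto
    show "\<alpha> g (z a) \<in> X" "z (p g a) \<in> X" using zX a b gc by auto
    fix h assume h: "h \<in> D"
    have hc: "h \<in> carrier G" "h \<in> E" using h D inE by auto
    (* the places seen from p g a within the reach of h are those seen from a, shifted by g *)
    have shift: "p (inv t \<otimes> (h \<otimes> g)) a = p (inv t \<otimes> h) (p g a)"
      "inv t \<otimes> h \<in> E" "inv t \<otimes> (h \<otimes> g) \<in> E" if t: "t \<in> F0" for t
    proof -
      have tc: "inv t \<in> F0" "inv t \<in> carrier G" using t F0_symmetric subsets by auto
      show 1: "inv t \<otimes> h \<in> E" "inv t \<otimes> (h \<otimes> g) \<in> E" using inE(2,3) tc h g by auto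
      show "p (inv t \<otimes> (h \<otimes> g)) a = p (inv t \<otimes> h) (p g a)"
        using mult[OF a 1(1) gc(2)] tc hc gc by (simp add: m_assoc)
    qed
    show "dist (\<alpha> h (\<alpha> g (z a))) (\<alpha> h (z (p g a))) \<le> 4 * \<epsilon>"
    (* whether h is near a place is the same question for both points, and near a place both follow its transplant *)
    proof (cases "\<exists>t\<in>F0. p (inv t \<otimes> h) (p g a) \<in> W")
      case True
      then obtain t where t: "t \<in> F0" and tW: "p (inv t \<otimes> h) (p g a) \<in> W" by blast
      have tc: "t \<in> carrier G" using t subsets by auto
      have "inv t \<otimes> h \<in> At (p g a)" "inv t \<otimes> (h \<otimes> g) \<in> At a"
        using tW shift[OF t] by (auto simp: At_def)
      from z_in[OF b this(1) t] z_in[OF a this(2) t]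
      have "dist (\<alpha> t (\<alpha> (inv t \<otimes> h) (z (p g a)))) (\<alpha> t (\<zeta> (\<phi> (p (inv t \<otimes> h) (p g a))))) \<le> 2 * \<epsilon>"
        "dist (\<alpha> t (\<alpha> (inv t \<otimes> (h \<otimes> g)) (z a))) (\<alpha> t (\<zeta> (\<phi> (p (inv t \<otimes> h) (p g a))))) \<le> 2 * \<epsilon>"
        using shift[OF t] by auto
      moreover have "\<alpha> t (\<alpha> (inv t \<otimes> h) (z (p g a))) = \<alpha> h (z (p g a))"
        using tc hc gc zX[OF b] by (simp add: act_act m_assoc[symmetric])
      moreover have "\<alpha> t (\<alpha> (inv t \<otimes> (h \<otimes> g)) (z a)) = \<alpha> h (\<alpha> g (z a))"
        using tc hc gc zX[OF a] by (simp add: act_act m_assoc[symmetric])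
      ultimately show ?thesis
        using dist_triangle2[of "\<alpha> h (\<alpha> g (z a))" "\<alpha> h (z (p g a))" "\<alpha> t (\<zeta> (\<phi> (p (inv t \<otimes> h) (p g a))))"]
        by simp
    next
      case False
      have "h \<notin> F0 <#> At (p g a)"
      proof
        assume "h \<in> F0 <#> At (p g a)"
        then obtain t s where ts: "t \<in> F0" "s \<in> At (p g a)" "h = t \<otimes> s" by (rule set_multE)
        then have "inv t \<otimes> h = s" using subsets At
          by (metis inv_solve_left' subsetD hc(1) inv_closed inv_inv inv_solve_left)
        then show False using False ts by (auto simp: At_def)
      qed
      then have 1: "dist (\<alpha> h (z (p g a))) (\<alpha> h (\<phi> (p g a))) \<le> \<epsilon>" using z_out[OF b] hc by blast
      have "h \<otimes> g \<notin> F0 <#> At a"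
      proof
        assume "h \<otimes> g \<in> F0 <#> At a"
        then obtain t s where ts: "t \<in> F0" "s \<in> At a" "h \<otimes> g = t \<otimes> s" by (rule set_multE)
        then have "inv t \<otimes> (h \<otimes> g) = s" using subsets At
          by (metis inv_solve_left' subsetD hc(1) gc(1) m_closed inv_closed inv_inv inv_solve_left)
        then show False using False ts shift[OF ts(1)] by (auto simp: At_def)
      qed
      then have "dist (\<alpha> (h \<otimes> g) (z a)) (\<alpha> (h \<otimes> g) (\<phi> a)) \<le> \<epsilon>" using z_out[OF a] hc gc by blast
      then have 2: "dist (\<alpha> h (\<alpha> g (z a))) (\<alpha> h (\<alpha> g (\<phi> a))) \<le> \<epsilon>"
        using hc gc zX[OF a] val a good_sub by (simp add: act_act subset_iff)
      have 3: "dist (\<alpha> h (\<phi> (p g a))) (\<alpha> h (\<alpha> g (\<phi> a))) \<le> \<epsilon>" using equiv[OF a hc(2) gc(2)] by simp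
      show ?thesis
        using 1 2 3 pos dist_triangle2[of "\<alpha> h (\<alpha> g (z a))" "\<alpha> h (\<phi> (p g a))" "\<alpha> h (\<alpha> g (\<phi> a))"]
          dist_triangle2[of "\<alpha> h (\<alpha> g (z a))" "\<alpha> h (z (p g a))" "\<alpha> h (\<phi> (p g a))"] by simp
    qed
  qed
  (* at a bad point any value in X does; the old one keeps the map unchanged there *)
  define \<phi>' where "\<phi>' = (\<lambda>a\<in>{1..n}. if a \<in> good then z a else \<phi> a)"
  have \<phi>'_good: "\<phi>' a = z a" if "a \<in> good" for a using that good_sub by (auto simp: \<phi>'_def)
  have \<phi>'_bad: "\<phi>' a = \<phi> a" if "a \<in> {1..n} - good" for a using that by (auto simp: \<phi>'_def)
  have val': "\<phi>' a \<in> X" if "a \<in> {1..n}" for a using that zX val by (auto simp: \<phi>'_def)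
  have "rho2 n (\<phi>' \<circ> p g) (\<lambda>a. \<alpha> g (\<phi>' a)) < \<delta>" if g: "g \<in> F" for g
  proof -
    have gc: "g \<in> carrier G" using g F by auto
    define B where "B = ({1..n} - good) \<union> (p g -` ({1..n} - good))"
    have finB: "finite B" unfolding B_def
      using permutes_inj[OF perm[OF gc]] by (intro finite_UnI finite_vimageI) auto
    have "card B \<le> card ({1..n} - good) + card (p g -` ({1..n} - good))" unfolding B_def by (rule card_Un_le)
    also have "card (p g -` ({1..n} - good)) \<le> card ({1..n} - good)"
      using card_vimage_inj_on_le[OF permutes_inj[OF perm[OF gc]], of "{1..n} - good"] by simp
    finally have "real (card B) \<le> 2 * real (card ({1..n} - good))" by linarith
    also have "\<dots> \<le> 2 * (\<kappa> * real n)" using bad by (simp add: good_def E_def)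
    finally have cB: "real (card B) \<le> 2 * \<kappa> * real n" by simp
    have pt: "(dist ((\<phi>' \<circ> p g) a) (\<alpha> g (\<phi>' a)))\<^sup>2 \<le> (\<delta> / 2)\<^sup>2 + (if a \<in> B then b\<^sup>2 else 0)"
      if a: "a \<in> {1..n}" for a
    proof (cases "a \<in> B")
      case True
      have "dist ((\<phi>' \<circ> p g) a) (\<alpha> g (\<phi>' a)) \<le> b" using a gc range val' by (intro diam) auto
      then show ?thesis using True by (simp add: power_mono add_increasing)
    next
      case False
      then have ab: "a \<in> good" "p g a \<in> good" using a range[OF gc a] by (auto simp: B_def)
      then have "dist ((\<phi>' \<circ> p g) a) (\<alpha> g (\<phi>' a)) \<le> \<delta> / 2"
        using equivariant[OF ab g] by (simp add: \<phi>'_good dist_commute)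
      then have "(dist ((\<phi>' \<circ> p g) a) (\<alpha> g (\<phi>' a)))\<^sup>2 \<le> (\<delta> / 2)\<^sup>2" by (intro power_mono) auto
      then show ?thesis using False by simp
    qed
    have "(\<Sum>a\<in>{1..n}. (dist ((\<phi>' \<circ> p g) a) (\<alpha> g (\<phi>' a)))\<^sup>2)
        \<le> (\<Sum>a\<in>{1..n}. (\<delta> / 2)\<^sup>2 + (if a \<in> B then b\<^sup>2 else 0))" by (rule sum_mono[OF pt])
    also have "\<dots> = real n * (\<delta> / 2)\<^sup>2 + real (card ({1..n} \<inter> B)) * b\<^sup>2"
      by (simp add: sum.distrib sum.If_cases)
    also have "\<dots> \<le> real n * (\<delta> / 2)\<^sup>2 + 2 * \<kappa> * real n * b\<^sup>2"
    proof -
      have "real (card ({1..n} \<inter> B)) \<le> real (card B)" using finB by (simp add: card_mono)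
      then show ?thesis using cB by (intro add_left_mono mult_right_mono) auto
    qed
    also have "\<dots> = real n * (\<delta>\<^sup>2 / 4 + 2 * \<kappa> * b\<^sup>2)" by (simp add: algebra_simps power2_eq_square)
    also have "\<dots> < real n * \<delta>\<^sup>2"
    proof -
      have "0 < \<delta>\<^sup>2" using \<open>0 < \<delta>\<close> by simp
      then have "\<delta>\<^sup>2 / 4 + 2 * \<kappa> * b\<^sup>2 < \<delta>\<^sup>2" using \<kappa> by linarith
      then show ?thesis using \<open>0 < n\<close> by (intro mult_strict_left_mono) auto
    qed
    finally have "(\<Sum>a\<in>{1..n}. (dist ((\<phi>' \<circ> p g) a) (\<alpha> g (\<phi>' a)))\<^sup>2) / real n < \<delta>\<^sup>2"
      using \<open>0 < n\<close> by (simp add: field_simps)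
    then have "sqrt ((\<Sum>a\<in>{1..n}. (dist ((\<phi>' \<circ> p g) a) (\<alpha> g (\<phi>' a)))\<^sup>2) / real n) < sqrt (\<delta>\<^sup>2)"
      by (rule real_sqrt_less_mono)
    then show ?thesis using \<open>0 < \<delta>\<close> by (simp add: rho2_def)
  qed
  then have "\<phi>' \<in> Map_sofic \<alpha> X F \<delta> n p"
    using val' by (auto simp: Map_sofic_def \<phi>'_def)
  moreover have near: "dist (\<phi>' w) x0 \<le> 3 * \<epsilon>" if w: "w \<in> W" for w
  proof -
    have wg: "w \<in> good" using w W by blast
    have "\<one> \<in> At w" using w p1[OF wg] \<open>\<one> \<in> E\<close> by (simp add: At_def)
    from z_in[OF wg this F0_symmetric(1)] have "dist (z w) (\<zeta> (\<phi> w)) \<le> 2 * \<epsilon>"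
      using zX[OF wg] transplant_closed val wg good_sub by (simp add: p1[OF wg] subset_iff)
    then show ?thesis
      using transplant_near[of "\<phi> w"] val wg good_sub dist_triangle[of "z w" x0 "\<zeta> (\<phi> w)"]
      by (auto simp: \<phi>'_good[OF wg])
  qed
  moreover have far: "dist (\<phi>' a) (\<phi> a) \<le> \<epsilon>" if a: "a \<in> {1..n} - (\<Union>t\<in>F0. p t ` W)" for a
  proof (cases "a \<in> good")
    case True
    have "\<one> \<notin> F0 <#> At a"
    proof
      assume "\<one> \<in> F0 <#> At a"
      then obtain t s where ts: "t \<in> F0" "s \<in> At a" "\<one> = t \<otimes> s" by (rule set_multE)
      then have "p t (p s a) = a" using mult[OF True, of t s] p1[OF True] inE by (simp add: At_def)
      then have "a \<in> p t ` W" using ts by (force simp: At_def)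
      then show False using a ts by blast
    qed
    then have "dist (\<alpha> \<one> (z a)) (\<alpha> \<one> (\<phi> a)) \<le> \<epsilon>" using z_out[OF True] by blast
    then show ?thesis using zX[OF True] val a by (simp add: \<phi>'_good[OF True])
  next
    case False
    then show ?thesis using a pos by (simp add: \<phi>'_bad)
  qed
  moreover have "dist (\<phi>' v) (\<phi> v) \<le> \<epsilon>" if v: "v \<in> V - W" for v
  proof (rule far)
    have "p t w \<noteq> v" if "t \<in> F0" "w \<in> W" for t w
    proof (cases "t = \<one>")
      case True
      then show ?thesis using p1[of w] that W v by auto
    next
      case False
      then show ?thesis using Vindep[of t w] that subsets(4) W v by blast
    qed
    then show "v \<in> {1..n} - (\<Union>t\<in>F0. p t ` W)" using v V by blast
  qed
  ultimately show ?thesis using that by blast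
qed

end

section \<open>Counting maps with surgery and with expansiveness\<close>

context replacement
begin

text \<open>
  Each \<open>\<phi> \<in> S\<close> is operated on along every set \<open>W\<close> of good places in \<open>V\<close>.  The result remembers \<open>W\<close> as the
  set of places of \<open>V\<close> where it is close to \<open>x0\<close> rather than to \<open>Y\<close>, and it remembers \<open>\<phi>\<close> except on
  at most \<open>|F0| |W|\<close> coordinates.  So \<open>W\<close> contributes with weight \<open>x ^ card W\<close>, where
  \<open>x = 1 / |N| ^ |F0|\<close>, and summing over \<open>W\<close> gives a factor \<open>1 + x\<close> for every good place.
\<close>

lemma many_models:
  fixes p :: "'a \<Rightarrow> nat \<Rightarrow> nat" and f :: "'b \<Rightarrow> 'c"
  assumes "0 < n" and perm: "\<And>s. s \<in> carrier G \<Longrightarrow> p s permutes {1..n}"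
    and V: "V \<subseteq> {1..n}" and Vindep: "\<And>k v. k \<in> K - {\<one>} \<Longrightarrow> v \<in> V \<Longrightarrow> p k v \<notin> V"
    and D: "finite D" "D \<subseteq> carrier G" and F: "finite F" "F \<subseteq> carrier G"
    and "0 < \<delta>" and window: "\<And>x y. x \<in> X \<Longrightarrow> y \<in> X \<Longrightarrow>
          (\<And>h. h \<in> D \<Longrightarrow> dist (\<alpha> h x) (\<alpha> h y) \<le> 4 * \<epsilon>) \<Longrightarrow> dist x y < \<delta> / 2"
    and diam: "\<And>x y. x \<in> X \<Longrightarrow> y \<in> X \<Longrightarrow> dist x y \<le> b" and \<kappa>: "2 * \<kappa> * b\<^sup>2 \<le> \<delta>\<^sup>2 / 4"
    and Y: "Y \<subseteq> X" "\<And>y. y \<in> Y \<Longrightarrow> 8 * \<epsilon> \<le> dist x0 y"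
    and code: "finite N" "N \<noteq> {}" "f \<in> X \<rightarrow> N"
      "\<And>x y. x \<in> X \<Longrightarrow> y \<in> X \<Longrightarrow> f x = f y \<Longrightarrow> dist x y < 4 * \<epsilon>"
    and S: "finite S" "S \<subseteq> {1..n} \<rightarrow>\<^sub>E Y" "pairwise (\<lambda>\<phi> \<psi>. rho_inf n \<phi> \<psi> \<ge> 4 * \<epsilon>) S"
    and bad: "\<And>\<phi>. \<phi> \<in> S \<Longrightarrow> real (card ({1..n} - good_points (window D F) (min \<tau> \<epsilon>) n p \<phi>)) \<le> \<kappa> * real n"
    and r: "r + \<kappa> * real n \<le> real (card V)"
  obtains T where "T \<subseteq> Map_sofic \<alpha> X F \<delta> n p" and "finite T"
    and "pairwise (\<lambda>\<phi> \<psi>. rho_inf n \<phi> \<psi> \<ge> \<epsilon>) T"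
    and "real (card S) * (1 + 1 / real (card N) ^ card F0) powr r \<le> real (card T)"
proof -
  define good where "good \<phi> = V \<inter> good_points (window D F) (min \<tau> \<epsilon>) n p \<phi>" for \<phi>
  define x where "x = 1 / real (card N) ^ card F0"
  have N: "0 < real (card N)" using code by (simp add: card_gt_0_iff)
  then have x: "0 < x" by (simp add: x_def)
  have finV: "finite V" using V finite_subset by blast
  have valY: "\<phi> a \<in> Y" if "\<phi> \<in> S" "a \<in> {1..n}" for \<phi> a using S that by blast
  have val: "\<phi> a \<in> X" if "\<phi> \<in> S" "a \<in> {1..n}" for \<phi> a using valY[OF that] Y by blast
  define Q where "Q W = (\<Union>t\<in>F0. p t ` W)" for W
  define result where "result \<phi> W \<phi>' \<longleftrightarrow> \<phi>' \<in> Map_sofic \<alpha> X F \<delta> n p \<and> (\<forall>w\<in>W. dist (\<phi>' w) x0 \<le> 3 * \<epsilon>) \<and>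
      (\<forall>a\<in>{1..n} - Q W. dist (\<phi>' a) (\<phi> a) \<le> \<epsilon>) \<and> (\<forall>v\<in>V - W. dist (\<phi>' v) (\<phi> v) \<le> \<epsilon>)" for \<phi> W \<phi>'
  define \<Phi> where "\<Phi> \<phi> W = (SOME \<phi>'. result \<phi> W \<phi>')" for \<phi> W
  have result: "result \<phi> W (\<Phi> \<phi> W)" if \<phi>: "\<phi> \<in> S" and W: "W \<subseteq> good \<phi>" for \<phi> W
    unfolding \<Phi>_def
  proof (rule someI_ex[of "result \<phi> W"])
    have \<phi>X: "\<phi> \<in> {1..n} \<rightarrow>\<^sub>E X" using \<phi> S(2) Y(1) by (auto simp: PiE_iff)
    obtain \<phi>' where "\<phi>' \<in> Map_sofic \<alpha> X F \<delta> n p" "\<And>w. w \<in> W \<Longrightarrow> dist (\<phi>' w) x0 \<le> 3 * \<epsilon>"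
      "\<And>a. a \<in> {1..n} - (\<Union>t\<in>F0. p t ` W) \<Longrightarrow> dist (\<phi>' a) (\<phi> a) \<le> \<epsilon>"
      "\<And>v. v \<in> V - W \<Longrightarrow> dist (\<phi>' v) (\<phi> v) \<le> \<epsilon>"
      by (rule surgery[OF \<open>0 < n\<close> perm V Vindep D F \<open>0 < \<delta>\<close> window \<phi>X W[unfolded good_def] bad[OF \<phi>] diam \<kappa>]) blast+
    then have "result \<phi> W \<phi>'" by (simp add: result_def Q_def)
    then show "\<exists>\<phi>'. result \<phi> W \<phi>'" by blast
  qed
  have \<Phi>: "\<And>\<phi> W. \<phi> \<in> S \<Longrightarrow> W \<subseteq> good \<phi> \<Longrightarrow> \<Phi> \<phi> W \<in> Map_sofic \<alpha> X F \<delta> n p"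
    and \<Phi>_in: "\<And>\<phi> W w. \<phi> \<in> S \<Longrightarrow> W \<subseteq> good \<phi> \<Longrightarrow> w \<in> W \<Longrightarrow> dist (\<Phi> \<phi> W w) x0 \<le> 3 * \<epsilon>"
    and \<Phi>_out: "\<And>\<phi> W a. \<phi> \<in> S \<Longrightarrow> W \<subseteq> good \<phi> \<Longrightarrow> a \<in> {1..n} - Q W \<Longrightarrow> dist (\<Phi> \<phi> W a) (\<phi> a) \<le> \<epsilon>"
    and \<Phi>_V: "\<And>\<phi> W v. \<phi> \<in> S \<Longrightarrow> W \<subseteq> good \<phi> \<Longrightarrow> v \<in> V - W \<Longrightarrow> dist (\<Phi> \<phi> W v) (\<phi> v) \<le> \<epsilon>"
    using result unfolding result_def by blast+
  define family where "family W T \<longleftrightarrow> T \<subseteq> {\<phi> \<in> S. W \<subseteq> good \<phi>} \<and>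
      x ^ card W * real (card {\<phi> \<in> S. W \<subseteq> good \<phi>}) \<le> real (card T) \<and>
      (\<forall>\<phi>\<in>T. \<forall>\<psi>\<in>T. \<phi> \<noteq> \<psi> \<longrightarrow> (\<exists>a\<in>{1..n} - Q W. 4 * \<epsilon> \<le> dist (\<phi> a) (\<psi> a)))" for W T
  have "\<exists>T. family W T" if W: "W \<in> Pow V" for W
  proof -
    have finW: "finite W" using W finV finite_subset by auto
    have QW: "Q W \<subseteq> {1..n}"
      unfolding Q_def using W V permutes_in_image[OF perm] subsets(1) by blast
    let ?SW = "{\<phi> \<in> S. W \<subseteq> good \<phi>}"
    have valW: "\<phi> a \<in> X" if "\<phi> \<in> ?SW" "a \<in> {1..n}" for \<phi> a using val that by blast
    have finSW: "finite ?SW" using S(1) by simp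
    have sepSW: "pairwise (\<lambda>\<phi> \<psi>. rho_inf n \<phi> \<psi> \<ge> 4 * \<epsilon>) ?SW" by (rule pairwise_subset[OF S(3)]) blast
    obtain T where T: "T \<subseteq> ?SW" and cT: "real (card ?SW) \<le> real (card N) ^ card (Q W) * real (card T)"
      and sepT: "\<And>\<phi> \<psi>. \<phi> \<in> T \<Longrightarrow> \<psi> \<in> T \<Longrightarrow> \<phi> \<noteq> \<psi> \<Longrightarrow> \<exists>a\<in>{1..n} - Q W. 4 * \<epsilon> \<le> dist (\<phi> a) (\<psi> a)"
      by (rule separated_outside[where S = ?SW and X = X and f = f and e = "4 * \<epsilon>", OF \<open>0 < n\<close> _ finSW sepSW code QW]) (use valW in blast)+
    have "card (Q W) \<le> (\<Sum>t\<in>F0. card (p t ` W))" unfolding Q_def by (rule card_UN_le[OF finite_sets(1)])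
    also have "\<dots> \<le> (\<Sum>t\<in>F0. card W)" by (intro sum_mono card_image_le finW)
    finally have "card (Q W) \<le> card F0 * card W" by simp
    then have "real (card N) ^ card (Q W) \<le> real (card N) ^ (card F0 * card W)"
      using N by (intro power_increasing) auto
    then have "real (card {\<phi> \<in> S. W \<subseteq> good \<phi>}) \<le> real (card N) ^ (card F0 * card W) * real (card T)"
      using cT by (meson mult_right_mono of_nat_0_le_iff order_trans)
    then have "x ^ card W * real (card {\<phi> \<in> S. W \<subseteq> good \<phi>}) \<le> real (card T)"
      using N by (simp add: x_def power_divide power_mult[symmetric] field_simps)
    then have "family W T" using T sepT by (simp add: family_def)
    then show ?thesis by blast
  qed
  then obtain T where family: "\<And>W. W \<in> Pow V \<Longrightarrow> family W (T W)" by metis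
  have T: "T W \<subseteq> {\<phi> \<in> S. W \<subseteq> good \<phi>}"
    and cT: "x ^ card W * real (card {\<phi> \<in> S. W \<subseteq> good \<phi>}) \<le> real (card (T W))" if "W \<in> Pow V" for W
    using family[OF that] by (simp_all add: family_def)
  have sepT: "\<exists>a\<in>{1..n} - Q W. 4 * \<epsilon> \<le> dist (\<phi> a) (\<psi> a)"
    if "W \<in> Pow V" and "\<phi> \<in> T W" "\<psi> \<in> T W" "\<phi> \<noteq> \<psi>" for W \<phi> \<psi>
    using family[OF that(1)] that(2-4) by (simp add: family_def)
  (* pairs of a set W and a map that is operated on along W *)
  define P where "P = Sigma (Pow V) T"
  have finT: "finite (T W)" if "W \<in> Pow V" for W
    using T[OF that] S(1) finite_subset by fastforce
  have finP: "finite P" unfolding P_def using finV finT by (intro finite_SigmaI) auto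
  have inP: "W \<in> Pow V" "\<phi> \<in> S" "W \<subseteq> good \<phi>" "\<phi> \<in> T W" if "(W, \<phi>) \<in> P" for W \<phi>
    using that T by (auto simp: P_def)
  have sep_new: "\<exists>a\<in>{1..n}. \<epsilon> \<le> dist (\<Phi> \<phi> W a) (\<Phi> \<psi> W' a)" if W: "(W, \<phi>) \<in> P" and W': "(W', \<psi>) \<in> P" "v \<in> W - W'" for W W' \<phi> \<psi> v
  proof -
    note i = inP[OF W] inP[OF W'(1)]
    have v: "v \<in> V - W'" "v \<in> {1..n}" using i W' V by auto
    have "dist (\<Phi> \<phi> W v) x0 \<le> 3 * \<epsilon>" using \<Phi>_in i W' by blast
    moreover have "dist (\<Phi> \<psi> W' v) (\<psi> v) \<le> \<epsilon>" using \<Phi>_V i v by blast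
    moreover have "8 * \<epsilon> \<le> dist x0 (\<psi> v)" using Y valY i v by blast
    ultimately have "\<epsilon> \<le> dist (\<Phi> \<phi> W v) (\<Phi> \<psi> W' v)"
      using pos dist_triangle3[of x0 "\<psi> v" "\<Phi> \<phi> W v"] dist_triangle[of "\<Phi> \<phi> W v" "\<psi> v" "\<Phi> \<psi> W' v"] by linarith
    then show ?thesis using v by blast
  qed
  have sep: "\<exists>a\<in>{1..n}. \<epsilon> \<le> dist (\<Phi> \<phi> W a) (\<Phi> \<psi> W' a)"
    if W: "(W, \<phi>) \<in> P" and W': "(W', \<psi>) \<in> P" and ne: "(W, \<phi>) \<noteq> (W', \<psi>)" for W W' \<phi> \<psi>
  proof (cases "W = W'")
    case True
    note i = inP[OF W] inP[OF W']
    obtain a where a: "a \<in> {1..n} - Q W" "4 * \<epsilon> \<le> dist (\<phi> a) (\<psi> a)"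
      using sepT[of W \<phi> \<psi>] i ne True by blast
    have "dist (\<Phi> \<phi> W a) (\<phi> a) \<le> \<epsilon>" "dist (\<Phi> \<psi> W' a) (\<psi> a) \<le> \<epsilon>"
      using \<Phi>_out i a True by blast+
    then have "\<epsilon> \<le> dist (\<Phi> \<phi> W a) (\<Phi> \<psi> W' a)"
      using a pos dist_triangle3[of "\<phi> a" "\<psi> a" "\<Phi> \<phi> W a"] dist_triangle[of "\<Phi> \<phi> W a" "\<psi> a" "\<Phi> \<psi> W' a"] by linarith
    then show ?thesis using a by blast
  next
    case False
    then consider v where "v \<in> W - W'" | v where "v \<in> W' - W" by blast
    then show ?thesis
      by cases (use sep_new[OF W W'] sep_new[OF W' W] in \<open>auto simp: dist_commute\<close>)
  qed
  define T' where "T' = (\<lambda>(W, \<phi>). \<Phi> \<phi> W) ` P"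
  have inj: "inj_on (\<lambda>(W, \<phi>). \<Phi> \<phi> W) P"
  proof (rule inj_onI, rule ccontr)
    fix q q' assume *: "q \<in> P" "q' \<in> P" "(case q of (W, \<phi>) \<Rightarrow> \<Phi> \<phi> W) = (case q' of (W, \<phi>) \<Rightarrow> \<Phi> \<phi> W)" "q \<noteq> q'"
    obtain W \<phi> W' \<psi> where q: "q = (W, \<phi>)" "q' = (W', \<psi>)" by fastforce
    then obtain a where "\<epsilon> \<le> dist (\<Phi> \<phi> W a) (\<Phi> \<psi> W' a)" using sep[of W \<phi> W' \<psi>] * by auto
    then show False using * q pos by simp
  qed
  show ?thesis
  proof (rule that[of T'])
    show "T' \<subseteq> Map_sofic \<alpha> X F \<delta> n p" using \<Phi> inP by (auto simp: T'_def)
    show "finite T'" using finP by (simp add: T'_def)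
    show "pairwise (\<lambda>\<phi> \<psi>. rho_inf n \<phi> \<psi> \<ge> \<epsilon>) T'"
      unfolding pairwise_def T'_def rho_inf_ge_iff[OF \<open>0 < n\<close>]
    proof (intro ballI impI, elim imageE)
      fix \<mu> \<mu>' q q' assume *: "\<mu> \<noteq> \<mu>'" "\<mu> = (case q of (W, \<phi>) \<Rightarrow> \<Phi> \<phi> W)" "\<mu>' = (case q' of (W, \<phi>) \<Rightarrow> \<Phi> \<phi> W)"
        "q \<in> P" "q' \<in> P"
      obtain W \<phi> W' \<psi> where q: "q = (W, \<phi>)" "q' = (W', \<psi>)" by fastforce
      then show "\<exists>a\<in>{1..n}. \<epsilon> \<le> dist (\<mu> a) (\<mu>' a)" using sep[of W \<phi> W' \<psi>] * by auto
    qed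
    have "(1 + x) powr r \<le> (1 + x) ^ card (good \<phi>)" if \<phi>: "\<phi> \<in> S" for \<phi>
    proof -
      have "card V \<le> card (good \<phi> \<union> ({1..n} - good_points (window D F) (min \<tau> \<epsilon>) n p \<phi>))"
        using V finV by (intro card_mono) (auto simp: good_def)
      also have "\<dots> \<le> card (good \<phi>) + card ({1..n} - good_points (window D F) (min \<tau> \<epsilon>) n p \<phi>)"
        by (rule card_Un_le)
      finally have "real (card V) \<le> real (card (good \<phi>)) + real (card ({1..n} - good_points (window D F) (min \<tau> \<epsilon>) n p \<phi>))"
        by linarith
      then have "r \<le> real (card (good \<phi>))" using r bad[OF \<phi>] by linarith
      then have "(1 + x) powr r \<le> (1 + x) powr real (card (good \<phi>))" using x by (intro powr_mono) auto
      then show ?thesis using x by (simp add: powr_realpow)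
    qed
    then have "real (card S) * (1 + x) powr r \<le> (\<Sum>\<phi>\<in>S. (1 + x) ^ card (good \<phi>))"
      using sum_bounded_below[of S "(1 + x) powr r" "\<lambda>\<phi>. (1 + x) ^ card (good \<phi>)"] by simp
    also have "\<dots> = (\<Sum>\<phi>\<in>S. \<Sum>W | W \<in> Pow V \<and> W \<subseteq> good \<phi>. x ^ card W)"
    proof (rule sum.cong[OF refl])
      fix \<phi>
      have "{W. W \<in> Pow V \<and> W \<subseteq> good \<phi>} = Pow (good \<phi>)" by (auto simp: good_def)
      then show "(1 + x) ^ card (good \<phi>) = (\<Sum>W | W \<in> Pow V \<and> W \<subseteq> good \<phi>. x ^ card W)"
        using sum_Pow_power_card[of "good \<phi>" x] finV by (simp add: good_def)
    qed
    also have "\<dots> = (\<Sum>W\<in>Pow V. x ^ card W * real (card {\<phi> \<in> S. W \<subseteq> good \<phi>}))"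
      using finV S(1) by (intro sum_swap_filter[symmetric]) auto
    also have "\<dots> \<le> (\<Sum>W\<in>Pow V. real (card (T W)))" by (rule sum_mono[OF cT])
    also have "\<dots> = real (card P)"
      unfolding P_def using finV finT by (subst card_SigmaI) auto
    also have "\<dots> = real (card T')" using inj by (simp add: T'_def card_image)
    finally show "real (card S) * (1 + 1 / real (card N) ^ card F0) powr r \<le> real (card T')"
      by (simp add: x_def)
  qed
qed

end

context compact_action
begin

text \<open>
  Two maps that are \<open>c / 4\<close>-close everywhere are \<open>e / 2\<close>-close at every point that is good for both, by
  expansiveness.  So a \<open>c / 4\<close>-ball contains few \<open>e\<close>-separated maps: they can differ at bad points only.
\<close>

lemma few_separated_in_ball:
  fixes p :: "'g \<Rightarrow> nat \<Rightarrow> nat" and f :: "'a \<Rightarrow> 'b"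
  assumes "0 < n" and perm: "\<And>s. s \<in> carrier G \<Longrightarrow> p s permutes {1..n}"
    and "0 < c" and D: "D \<subseteq> carrier G" and window: "\<And>x y. x \<in> X \<Longrightarrow> y \<in> X \<Longrightarrow>
          (\<And>h. h \<in> D \<Longrightarrow> dist (\<alpha> h x) (\<alpha> h y) \<le> c) \<Longrightarrow> dist x y < e / 2"
    and code: "finite N" "f \<in> X \<rightarrow> N" "\<And>x y. x \<in> X \<Longrightarrow> y \<in> X \<Longrightarrow> f x = f y \<Longrightarrow> dist x y < e"
    and S: "finite S" "S \<subseteq> {1..n} \<rightarrow>\<^sub>E X" "pairwise (\<lambda>\<phi> \<psi>. rho_inf n \<phi> \<psi> \<ge> e) S"
    and bad: "\<And>\<phi>. \<phi> \<in> S \<Longrightarrow> real (card ({1..n} - good_points (insert \<one> D) (c / 4) n p \<phi>)) \<le> \<kappa> / 2 * real n"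
    and \<phi>: "\<phi> \<in> S"
  shows "real (card {\<psi> \<in> S. rho_inf n \<phi> \<psi> < c / 4})
      \<le> (\<Sum>B | B \<subseteq> {1..n} \<and> real (card B) \<le> \<kappa> * real n. real (card N) ^ card B)"
proof -
  define \<B> where "\<B> = {B. B \<subseteq> {1..n} \<and> real (card B) \<le> \<kappa> * real n}"
  define Bd where "Bd \<psi> = {a \<in> {1..n}. e / 2 \<le> dist (\<phi> a) (\<psi> a)}" for \<psi>
  define good where "good \<psi> = good_points (insert \<one> D) (c / 4) n p \<psi>" for \<psi>
  let ?ball = "{\<psi> \<in> S. rho_inf n \<phi> \<psi> < c / 4}"
  have val: "\<psi> a \<in> X" if "\<psi> \<in> S" "a \<in> {1..n}" for \<psi> a using S that by blast
  have fin: "finite \<B>" by (rule finite_subset[of _ "Pow {1..n}"]) (auto simp: \<B>_def)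
  have finB: "finite B" if "B \<in> \<B>" for B using that finite_subset by (auto simp: \<B>_def)
  have Bd: "Bd \<psi> \<in> \<B>" if \<psi>: "\<psi> \<in> ?ball" for \<psi>
  proof -
    have "Bd \<psi> \<subseteq> ({1..n} - good \<phi>) \<union> ({1..n} - good \<psi>)"
    proof
      fix a assume a: "a \<in> Bd \<psi>"
      have "dist (\<phi> a) (\<psi> a) < e / 2" if g: "a \<in> good \<phi>" "a \<in> good \<psi>"
      proof (rule window)
        have an: "a \<in> {1..n}" using a by (simp add: Bd_def)
        show "\<phi> a \<in> X" "\<psi> a \<in> X" using val[OF \<phi> an] val[OF _ an] \<psi> by auto
        fix h assume h: "h \<in> D"
        then have ph: "p h a \<in> {1..n}" using permutes_in_image[OF perm] an D by blast
        have vp: "\<phi> (p h a) \<in> X" "\<psi> (p h a) \<in> X" using val[OF \<phi> ph] val[OF _ ph] \<psi> by auto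
        have "dist (\<phi> (p h a)) (\<psi> (p h a)) < c / 4"
          using \<psi> ph rho_inf_less_iff[OF \<open>0 < n\<close>] by blast
        moreover have "dist (\<alpha> \<one> (\<phi> (p h a))) (\<alpha> \<one> (\<alpha> h (\<phi> a))) \<le> c / 4"
          "dist (\<alpha> \<one> (\<psi> (p h a))) (\<alpha> \<one> (\<alpha> h (\<psi> a))) \<le> c / 4"
          using g h by (auto simp: good_def good_points_def)
        (* three errors of size c / 4 *)
        ultimately show "dist (\<alpha> h (\<phi> a)) (\<alpha> h (\<psi> a)) \<le> c"
          using vp \<open>\<phi> a \<in> X\<close> \<open>\<psi> a \<in> X\<close> h D \<open>0 < c\<close>
            dist_triangle3[of "\<alpha> h (\<phi> a)" "\<alpha> h (\<psi> a)" "\<phi> (p h a)"] dist_triangle[of "\<phi> (p h a)" "\<alpha> h (\<psi> a)" "\<psi> (p h a)"]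
          by (simp add: subset_iff)
      qed
      then show "a \<in> ({1..n} - good \<phi>) \<union> ({1..n} - good \<psi>)" using a by (force simp: Bd_def)
    qed
    then have "card (Bd \<psi>) \<le> card (({1..n} - good \<phi>) \<union> ({1..n} - good \<psi>))" by (intro card_mono) auto
    also have "\<dots> \<le> card ({1..n} - good \<phi>) + card ({1..n} - good \<psi>)" by (rule card_Un_le)
    finally have "real (card (Bd \<psi>)) \<le> real (card ({1..n} - good \<phi>)) + real (card ({1..n} - good \<psi>))" by linarith
    also have "\<dots> \<le> \<kappa> * real n" using bad[OF \<phi>] bad[of \<psi>] \<psi> by (simp add: good_def)
    finally show ?thesis by (auto simp: \<B>_def Bd_def)
  qed
  have "card ?ball \<le> card (Sigma \<B> (\<lambda>B. B \<rightarrow>\<^sub>E N))"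
  proof (rule card_inj_on_le)
    show "inj_on (\<lambda>\<psi>. (Bd \<psi>, restrict (f \<circ> \<psi>) (Bd \<psi>))) ?ball"
    proof (rule inj_onI, rule ccontr)
      fix \<psi>1 \<psi>2 assume b1: "\<psi>1 \<in> ?ball" and b2: "\<psi>2 \<in> ?ball" and ne: "\<psi>1 \<noteq> \<psi>2"
        and eq: "(Bd \<psi>1, restrict (f \<circ> \<psi>1) (Bd \<psi>1)) = (Bd \<psi>2, restrict (f \<circ> \<psi>2) (Bd \<psi>2))"
      have "e \<le> rho_inf n \<psi>1 \<psi>2" using S(3) b1 b2 ne by (auto simp: pairwise_def)
      then obtain a where a: "a \<in> {1..n}" "e \<le> dist (\<psi>1 a) (\<psi>2 a)"
        using rho_inf_ge_iff[OF \<open>0 < n\<close>] by blast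
      show False
      proof (cases "a \<in> Bd \<psi>1")
        case True
        then have "a \<in> Bd \<psi>2" using eq by simp
        have "restrict (f \<circ> \<psi>1) (Bd \<psi>1) = restrict (f \<circ> \<psi>2) (Bd \<psi>2)" using eq by blast
        from fun_cong[OF this, of a] have "f (\<psi>1 a) = f (\<psi>2 a)" using True \<open>a \<in> Bd \<psi>2\<close> by simp
        then show False using code(3)[of "\<psi>1 a" "\<psi>2 a"] val[OF _ a(1)] b1 b2 a by auto
      next
        case False
        then have "a \<notin> Bd \<psi>2" using eq by simp
        then show False
          using False a dist_triangle3[of "\<psi>1 a" "\<psi>2 a" "\<phi> a"] by (auto simp: Bd_def)
      qed
    qed
    show "(\<lambda>\<psi>. (Bd \<psi>, restrict (f \<circ> \<psi>) (Bd \<psi>))) ` ?ball \<subseteq> Sigma \<B> (\<lambda>B. B \<rightarrow>\<^sub>E N)"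
    proof
      fix q assume "q \<in> (\<lambda>\<psi>. (Bd \<psi>, restrict (f \<circ> \<psi>) (Bd \<psi>))) ` ?ball"
      then obtain \<psi> where \<psi>: "\<psi> \<in> ?ball" "q = (Bd \<psi>, restrict (f \<circ> \<psi>) (Bd \<psi>))" by blast
      have "f (\<psi> a) \<in> N" if "a \<in> Bd \<psi>" for a
        using that val[of \<psi> a] \<psi>(1) code(2) by (auto simp: Bd_def)
      then have "restrict (f \<circ> \<psi>) (Bd \<psi>) \<in> Bd \<psi> \<rightarrow>\<^sub>E N" by (simp add: PiE_iff)
      then show "q \<in> Sigma \<B> (\<lambda>B. B \<rightarrow>\<^sub>E N)" using Bd[OF \<psi>(1)] \<psi>(2) by blast
    qed
    show "finite (Sigma \<B> (\<lambda>B. B \<rightarrow>\<^sub>E N))" using fin finB code(1) by (intro finite_SigmaI finite_PiE) auto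
  qed
  also have "\<dots> = (\<Sum>B\<in>\<B>. card (B \<rightarrow>\<^sub>E N))" using fin finB code(1) by (intro card_SigmaI ballI finite_PiE) auto
  also have "\<dots> = (\<Sum>B\<in>\<B>. card N ^ card B)" using finB by (intro sum.cong refl) (simp add: card_PiE)
  finally have "real (card ?ball) \<le> real (\<Sum>B\<in>\<B>. card N ^ card B)" by (simp only: of_nat_le_iff)
  then show ?thesis by (simp add: \<B>_def)
qed

text \<open>
  For an expansive action the separation scale matters only up to subexponential factors, once the
  maps are sufficiently equivariant.
\<close>

lemma thin_to_expansive_scale:
  assumes sof: "sofic_approximation G d \<sigma>" and "0 < c"
    and exp: "\<And>x y. x \<in> X \<Longrightarrow> y \<in> X \<Longrightarrow> x \<noteq> y \<Longrightarrow> \<exists>g\<in>carrier G. c < dist (\<alpha> g x) (\<alpha> g y)"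
    and "0 < e" and "0 < \<eta>"
  obtains E \<delta> where "finite E" and "E \<subseteq> carrier G" and "0 < \<delta>"
    and "\<forall>\<^sub>F j in sequentially. \<forall>S. finite S \<longrightarrow> S \<subseteq> Map_sofic \<alpha> X E \<delta> (d j) (\<sigma> j) \<longrightarrow>
           pairwise (\<lambda>\<phi> \<psi>. rho_inf (d j) \<phi> \<psi> \<ge> e) S \<longrightarrow>
           (\<exists>T\<subseteq>S. pairwise (\<lambda>\<phi> \<psi>. rho_inf (d j) \<phi> \<psi> \<ge> c / 4) T \<and>
              real (card S) \<le> exp (\<eta> * real (d j)) * real (card T))"
proof -
  obtain N and f :: "'a \<Rightarrow> 'a" where code: "finite N" "N \<noteq> {}" "f \<in> X \<rightarrow> N"
    "\<And>x y. x \<in> X \<Longrightarrow> y \<in> X \<Longrightarrow> f x = f y \<Longrightarrow> dist x y < e"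
    using compact_finite_code[OF compact_space \<open>0 < e\<close>] by blast
  then have "0 < real (card N)" by (simp add: card_gt_0_iff)
  then obtain \<kappa> where "0 < \<kappa>"
    and rate: "\<And>n. (\<Sum>B | B \<subseteq> {1..n::nat} \<and> real (card B) \<le> \<kappa> * real n. real (card N) ^ card B) \<le> exp (\<eta> * real n)"
    using small_subsets_rate[OF _ \<open>0 < \<eta>\<close>] by blast
  obtain D where D: "finite D" "D \<subseteq> carrier G" and window: "\<And>x y. x \<in> X \<Longrightarrow> y \<in> X \<Longrightarrow>
      (\<And>h. h \<in> D \<Longrightarrow> dist (\<alpha> h x) (\<alpha> h y) \<le> c) \<Longrightarrow> dist x y < e / 2"
    using expansive_finite_window[OF exp half_gt_zero[OF \<open>0 < e\<close>]] by blast
  have E: "finite (insert \<one> D)" "insert \<one> D \<subseteq> carrier G" using D by auto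
  obtain \<delta> where "0 < \<delta>" and few: "\<forall>\<^sub>F j in sequentially. \<forall>\<phi>\<in>Map_sofic \<alpha> X (insert \<one> D) \<delta> (d j) (\<sigma> j).
      real (card ({1..d j} - good_points (insert \<one> D) (c / 4) (d j) (\<sigma> j) \<phi>)) \<le> \<kappa> / 2 * real (d j)"
    by (rule few_bad_points[OF sof E, of "c / 4" "\<kappa> / 2"]) (use \<open>0 < c\<close> \<open>0 < \<kappa>\<close> in auto)
  show ?thesis
  proof (rule that[OF E \<open>0 < \<delta>\<close>], rule eventually_mono[OF few], intro allI impI)
    fix j S
    assume few: "\<forall>\<phi>\<in>Map_sofic \<alpha> X (insert \<one> D) \<delta> (d j) (\<sigma> j).
        real (card ({1..d j} - good_points (insert \<one> D) (c / 4) (d j) (\<sigma> j) \<phi>)) \<le> \<kappa> / 2 * real (d j)"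
      and S: "finite S" "S \<subseteq> Map_sofic \<alpha> X (insert \<one> D) \<delta> (d j) (\<sigma> j)"
        "pairwise (\<lambda>\<phi> \<psi>. rho_inf (d j) \<phi> \<psi> \<ge> e) S"
    have n: "0 < d j" by (rule sofic_dim_pos[OF sof])
    have SX: "S \<subseteq> {1..d j} \<rightarrow>\<^sub>E X" using S(2) by (auto simp: Map_sofic_def)
    obtain T where T: "T \<subseteq> S" "pairwise (\<lambda>\<phi> \<psi>. rho_inf (d j) \<phi> \<psi> \<ge> c / 4) T"
      "S \<subseteq> (\<Union>\<phi>\<in>T. {\<psi> \<in> S. rho_inf (d j) \<phi> \<psi> < c / 4})"
      by (rule maximal_separated_subset[OF n _ S(1), of "c / 4"]) (use \<open>0 < c\<close> in auto)
    have finT: "finite T" using T(1) S(1) finite_subset by blast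
    have "card S \<le> card (\<Union>\<phi>\<in>T. {\<psi> \<in> S. rho_inf (d j) \<phi> \<psi> < c / 4})"
      using finT S(1) by (intro card_mono[OF _ T(3)]) auto
    also have "\<dots> \<le> (\<Sum>\<phi>\<in>T. card {\<psi> \<in> S. rho_inf (d j) \<phi> \<psi> < c / 4})" by (rule card_UN_le[OF finT])
    finally have "real (card S) \<le> (\<Sum>\<phi>\<in>T. real (card {\<psi> \<in> S. rho_inf (d j) \<phi> \<psi> < c / 4}))"
      by (simp only: of_nat_sum[symmetric] of_nat_le_iff)
    also have "\<dots> \<le> (\<Sum>\<phi>\<in>T. exp (\<eta> * real (d j)))"
    proof (rule sum_mono)
      fix \<phi> assume "\<phi> \<in> T"
      then have "\<phi> \<in> S" using T by blast
      have "real (card {\<psi> \<in> S. rho_inf (d j) \<phi> \<psi> < c / 4})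
          \<le> (\<Sum>B | B \<subseteq> {1..d j} \<and> real (card B) \<le> \<kappa> * real (d j). real (card N) ^ card B)"
      proof (rule few_separated_in_ball[OF n sofic_permutes[OF sof] \<open>0 < c\<close> D(2) window code(1,3,4) S(1) SX S(3)])
        show "real (card ({1..d j} - good_points (insert \<one> D) (c / 4) (d j) (\<sigma> j) \<psi>)) \<le> \<kappa> / 2 * real (d j)"
          if "\<psi> \<in> S" for \<psi>
          using few that S(2) by (meson subsetD)
      qed (assumption | rule \<open>\<phi> \<in> S\<close>)+
      then show "real (card {\<psi> \<in> S. rho_inf (d j) \<phi> \<psi> < c / 4}) \<le> exp (\<eta> * real (d j))"
        using rate[of "d j"] by linarith
    qed
    finally have "real (card S) \<le> exp (\<eta> * real (d j)) * real (card T)" by (simp add: mult.commute)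
    then show "\<exists>T\<subseteq>S. pairwise (\<lambda>\<phi> \<psi>. rho_inf (d j) \<phi> \<psi> \<ge> c / 4) T \<and>
        real (card S) \<le> exp (\<eta> * real (d j)) * real (card T)" using T by blast
  qed
qed

end

section \<open>The entropy gap\<close>

lemma Map_sofic_subset_PiE: "Map_sofic \<alpha> X F \<delta> n p \<subseteq> {1..n} \<rightarrow>\<^sub>E X"
  unfolding Map_sofic_def by blast

lemma Map_sofic_mono:
  "E \<subseteq> E' \<Longrightarrow> \<delta>' \<le> \<delta> \<Longrightarrow> Map_sofic \<alpha> X E' \<delta>' n p \<subseteq> Map_sofic \<alpha> X E \<delta> n p"
  unfolding Map_sofic_def by force

lemma Map_sofic_restrict_subset:
  assumes "Y \<subseteq> X"
  shows "Map_sofic (restrict_action \<alpha> Y) Y E \<delta> n p \<subseteq> Map_sofic \<alpha> X E \<delta> n p"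
proof
  fix \<phi> assume \<phi>: "\<phi> \<in> Map_sofic (restrict_action \<alpha> Y) Y E \<delta> n p"
  then have Y: "\<And>a. a \<in> {1..n} \<Longrightarrow> \<phi> a \<in> Y" by (auto simp: Map_sofic_def)
  have "rho2 n (\<phi> \<circ> p s) (\<lambda>a. restrict_action \<alpha> Y s (\<phi> a)) = rho2 n (\<phi> \<circ> p s) (\<lambda>a. \<alpha> s (\<phi> a))" for s
    unfolding rho2_def restrict_action_def using Y
    by (intro arg_cong[where f = sqrt] arg_cong2[where f = "(/)"] sum.cong refl) simp
  then show "\<phi> \<in> Map_sofic \<alpha> X E \<delta> n p" using \<phi> \<open>Y \<subseteq> X\<close> by (auto simp: Map_sofic_def PiE_iff)
qed

lemma log_growth_le:
  assumes "0 < (n::nat)" and "exp (\<eta> * real n) * real k \<le> real m"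
  shows "ereal (1 / real n) * log_enat (enat k) + ereal \<eta> \<le> ereal (1 / real n) * log_enat (enat m)"
proof (cases "k = 0")
  case True
  then show ?thesis using assms by (simp add: log_enat_def zero_enat_def)
next
  case False
  have "0 < exp (\<eta> * real n) * real k" using False by simp
  then have m: "0 < real m" using assms by linarith
  have "ln (exp (\<eta> * real n) * real k) \<le> ln (real m)"
    using assms(2) \<open>0 < exp (\<eta> * real n) * real k\<close> m by simp
  then have "\<eta> * real n + ln (real k) \<le> ln (real m)" using False by (simp add: ln_mult)
  then have "(\<eta> * real n + ln (real k)) / real n \<le> ln (real m) / real n" by (rule divide_right_mono) simp
  then have "ln (real k) / real n + \<eta> \<le> ln (real m) / real n" using assms(1) by (simp add: add_divide_distrib)
  then show ?thesis using False m by (simp add: log_enat_def zero_enat_def)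
qed

definition scale_entropy :: "(nat \<Rightarrow> nat) \<Rightarrow> real \<Rightarrow> (nat \<Rightarrow> (nat \<Rightarrow> 'a::metric_space) set) \<Rightarrow> ereal" where
  "scale_entropy d e M = limsup (\<lambda>j. ereal (1 / real (d j)) * log_enat (sep_number (d j) e (M j)))"

lemma scale_entropy_gain:
  assumes pos: "\<And>j. 0 < d j" and fin: "\<And>j. sep_number (d j) e (A j) \<noteq> \<infinity>" "\<And>j. sep_number (d j) \<epsilon> (B j) \<noteq> \<infinity>"
    and more: "\<forall>\<^sub>F j in sequentially. \<forall>S. finite S \<longrightarrow> S \<subseteq> A j \<longrightarrow> pairwise (\<lambda>\<phi> \<psi>. rho_inf (d j) \<phi> \<psi> \<ge> e) S \<longrightarrow>
           (\<exists>T. finite T \<and> T \<subseteq> B j \<and> pairwise (\<lambda>\<phi> \<psi>. rho_inf (d j) \<phi> \<psi> \<ge> \<epsilon>) T \<and>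
              exp (\<eta> * real (d j)) * real (card S) \<le> real (card T))"
  shows "scale_entropy d e A + ereal \<eta> \<le> scale_entropy d \<epsilon> B"
proof -
  have "\<forall>\<^sub>F j in sequentially. ereal (1 / real (d j)) * log_enat (sep_number (d j) e (A j)) + ereal \<eta>
        \<le> ereal (1 / real (d j)) * log_enat (sep_number (d j) \<epsilon> (B j))"
    using more
  proof eventually_elim
    case (elim j)
    obtain S where S: "S \<subseteq> A j" "finite S" "pairwise (\<lambda>\<phi> \<psi>. rho_inf (d j) \<phi> \<psi> \<ge> e) S"
      "sep_number (d j) e (A j) = enat (card S)" by (rule sep_number_attained[OF fin(1)])
    then obtain T where T: "finite T" "T \<subseteq> B j" "pairwise (\<lambda>\<phi> \<psi>. rho_inf (d j) \<phi> \<psi> \<ge> \<epsilon>) T"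
      and cT: "exp (\<eta> * real (d j)) * real (card S) \<le> real (card T)" using elim by metis
    obtain m where m: "sep_number (d j) \<epsilon> (B j) = enat m" using fin(2)[of j] by auto
    have "card T \<le> m" using sep_number_ge[OF T(2,1,3)] m by simp
    then have "exp (\<eta> * real (d j)) * real (card S) \<le> real m" using cT by linarith
    from log_growth_le[OF pos this] show ?case using S m by simp
  qed
  then show ?thesis
    unfolding scale_entropy_def by (subst Limsup_add_ereal_right[symmetric]) (auto intro: Limsup_mono)
qed

context compact_action
begin

lemma sep_number_finite:
  assumes "0 < n" and "0 < e" and "M \<subseteq> {1..n} \<rightarrow>\<^sub>E X"
  shows "sep_number n e M \<noteq> \<infinity>"
proof -
  obtain N and f :: "'a \<Rightarrow> 'a" where code: "finite N" "N \<noteq> {}" "f \<in> X \<rightarrow> N"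
    "\<And>x y. x \<in> X \<Longrightarrow> y \<in> X \<Longrightarrow> f x = f y \<Longrightarrow> dist x y < e"
    using compact_finite_code[OF compact_space \<open>0 < e\<close>] by blast
  have "sep_number n e M \<le> enat (card N ^ n)" by (rule sep_number_le_code[OF assms(1,3) code(1,3,4)])
  from enat_ile[OF this] show ?thesis by auto
qed

lemma large_independent_places:
  assumes sof: "sofic_approximation G d \<sigma>" and K: "finite K" "K \<subseteq> carrier G" "\<one> \<notin> K"
  shows "\<forall>\<^sub>F j in sequentially. \<exists>V\<subseteq>{1..d j}. (\<forall>k\<in>K. \<forall>v\<in>V. \<sigma> j k v \<notin> V) \<and>
           real (d j) \<le> 2 * (2 * real (card K) + 1) * real (card V)"
proof -
  let ?fix = "\<lambda>j. {a \<in> {1..d j}. \<exists>k\<in>K. \<sigma> j k a = a}"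
  have "\<forall>\<^sub>F j in sequentially. real (card (?fix j)) \<le> 1 / 2 * real (d j)"
    by (rule sparse_sets_eventually[OF sofic_fixed_points_sparse[OF sof is_group K] sofic_dim_pos[OF sof]]) simp
  then show ?thesis
  proof (rule eventually_mono)
    fix j assume few: "real (card (?fix j)) \<le> 1 / 2 * real (d j)"
    have inj: "inj (\<sigma> j k)" if "k \<in> K" for k using permutes_inj[OF sofic_permutes[OF sof]] that K by blast
    obtain V where V: "V \<subseteq> {1..d j} - ?fix j" "\<And>k v. k \<in> K \<Longrightarrow> v \<in> V \<Longrightarrow> \<sigma> j k v \<notin> V"
      "card ({1..d j} - ?fix j) \<le> (2 * card K + 1) * card V"
      by (rule large_independent_set[OF K(1) _ inj, of "{1..d j} - ?fix j"]) auto
    have "card ({1..d j} - ?fix j) = d j - card (?fix j)" by (subst card_Diff_subset) auto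
    then have "real (d j) \<le> real (card (?fix j)) + real ((2 * card K + 1) * card V)" using V(3) by linarith
    then have "real (d j) \<le> 2 * real ((2 * card K + 1) * card V)" using few by linarith
    then have "real (d j) \<le> 2 * (2 * real (card K) + 1) * real (card V)" by (simp add: algebra_simps)
    moreover have "V \<subseteq> {1..d j}" "\<forall>k\<in>K. \<forall>v\<in>V. \<sigma> j k v \<notin> V" using V(1,2) by blast+
    ultimately show "\<exists>V\<subseteq>{1..d j}. (\<forall>k\<in>K. \<forall>v\<in>V. \<sigma> j k v \<notin> V) \<and>
        real (d j) \<le> 2 * (2 * real (card K) + 1) * real (card V)" by (intro exI[of _ V] conjI)
  qed
qed

text \<open>
  The constants are chosen in this order: \<open>\<epsilon>\<close> from the expansive constant and the distance of \<open>x0\<close> to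
  \<open>Y\<close>; the replacement data from \<open>\<epsilon>\<close>; the density \<open>\<theta>\<close> of independent places from \<open>K\<close>; the rate \<open>\<eta>\<close>
  from \<open>\<theta>\<close>, \<open>F0\<close> and the number of codes.  Only the accuracy required of the maps into \<open>Y\<close> depends on
  the scale \<open>e\<close> and on the neighbourhood \<open>(F, \<delta>)\<close>, and so the gain \<open>\<eta>\<close> is uniform in them.
\<close>

lemma exponential_gain:
  assumes sof: "sofic_approximation G d \<sigma>" and "0 < c"
    and exp: "\<And>x y. x \<in> X \<Longrightarrow> y \<in> X \<Longrightarrow> x \<noteq> y \<Longrightarrow> \<exists>g\<in>carrier G. c < dist (\<alpha> g x) (\<alpha> g y)"
    and ws: "weak_specification G X \<alpha>" and stm: "strong_topological_Markov G X \<alpha>"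
    and "Y \<subseteq> X" and x0: "x0 \<in> X" and "0 < r0" and r0: "\<And>y. y \<in> Y \<Longrightarrow> r0 \<le> dist x0 y"
  obtains \<epsilon> \<eta> :: real where "0 < \<epsilon>" and "0 < \<eta>"
    and "\<forall>e>0. \<forall>F. \<forall>\<delta>>0. finite F \<longrightarrow> F \<subseteq> carrier G \<longrightarrow>
           (\<exists>E \<delta>'. finite E \<and> E \<noteq> {} \<and> E \<subseteq> carrier G \<and> 0 < \<delta>' \<and>
             scale_entropy d e (\<lambda>j. Map_sofic (restrict_action \<alpha> Y) Y E \<delta>' (d j) (\<sigma> j)) + ereal \<eta>
             \<le> scale_entropy d \<epsilon> (\<lambda>j. Map_sofic \<alpha> X F \<delta> (d j) (\<sigma> j)))"
proof -
  (* 16 \<epsilon> serves as expansive constant: thinning at a quarter of it leaves maps that are 4 \<epsilon>-separated, and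
     surgery needs windows at 4 \<epsilon>; 8 \<epsilon> \<le> r0 keeps values near x0 and values near Y apart *)
  define \<epsilon> where "\<epsilon> = min (c / 16) (r0 / 8)"
  have \<epsilon>: "0 < \<epsilon>" "16 * \<epsilon> \<le> c" "8 * \<epsilon> \<le> r0" using \<open>0 < c\<close> \<open>0 < r0\<close> by (auto simp: \<epsilon>_def min_def)
  have exp16: "\<exists>g\<in>carrier G. 16 * \<epsilon> < dist (\<alpha> g x) (\<alpha> g y)" if "x \<in> X" "y \<in> X" "x \<noteq> y" for x y
    using exp[OF that] \<epsilon>(2) by (meson le_less_trans)
  have exp4: "\<exists>g\<in>carrier G. 4 * \<epsilon> < dist (\<alpha> g x) (\<alpha> g y)" if "x \<in> X" "y \<in> X" "x \<noteq> y" for x y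
  proof -
    have "4 * \<epsilon> < 16 * \<epsilon>" using \<epsilon>(1) by simp
    then show ?thesis using exp16[OF that] by (meson less_trans)
  qed
  have "0 < 4 * \<epsilon>" using \<epsilon>(1) by simp
  obtain \<tau> F0 M K \<zeta> where "replacement G X \<alpha> x0 \<epsilon> \<tau> F0 M K \<zeta>"
    by (rule local_replacement[OF ws stm x0 \<epsilon>(1)])
  then interpret R: replacement G X \<alpha> x0 \<epsilon> \<tau> F0 M K \<zeta> .
  obtain N and f :: "'a \<Rightarrow> 'a" where code: "finite N" "N \<noteq> {}" "f \<in> X \<rightarrow> N"
    "\<And>x y. x \<in> X \<Longrightarrow> y \<in> X \<Longrightarrow> f x = f y \<Longrightarrow> dist x y < 4 * \<epsilon>"
    using compact_finite_code[OF compact_space \<open>0 < 4 * \<epsilon>\<close>] by blast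
  define K' where "K' = K - {\<one>}"
  have K': "finite K'" "K' \<subseteq> carrier G" "\<one> \<notin> K'"
    using R.finite_sets R.subsets by (auto simp: K'_def)
  define \<theta> where "\<theta> = 1 / (4 * (2 * real (card K') + 1))"
  define x where "x = 1 / real (card N) ^ card F0"
  define \<eta> where "\<eta> = \<theta> * ln (1 + x) / 2"
  have "0 < \<theta>" by (simp add: \<theta>_def add_nonneg_pos)
  have "0 < x" using code by (simp add: x_def card_gt_0_iff)
  then have "0 < \<eta>" using \<open>0 < \<theta>\<close> by (simp add: \<eta>_def)
  obtain b where diam: "\<And>x y. x \<in> X \<Longrightarrow> y \<in> X \<Longrightarrow> dist x y \<le> b"
    using compact_imp_bounded[OF compact_space] unfolding bounded_two_points by blast
  show ?thesis
  proof (rule that[OF \<epsilon>(1) \<open>0 < \<eta>\<close>], intro allI impI)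
    fix e \<delta> :: real and F
    assume "0 < e" and F: "finite F" "F \<subseteq> carrier G" and "0 < \<delta>"
    obtain D where D: "finite D" "D \<subseteq> carrier G" and window: "\<And>x y. x \<in> X \<Longrightarrow> y \<in> X \<Longrightarrow>
        (\<And>h. h \<in> D \<Longrightarrow> dist (\<alpha> h x) (\<alpha> h y) \<le> 4 * \<epsilon>) \<Longrightarrow> dist x y < \<delta> / 2"
      using expansive_finite_window[OF exp4 half_gt_zero[OF \<open>0 < \<delta>\<close>]] by blast
    (* b\<^sup>2 + 1 instead of b\<^sup>2 because X may be a single point *)
  define \<kappa> where "\<kappa> = min \<theta> (\<delta>\<^sup>2 / (8 * (b\<^sup>2 + 1)))"
    have b1: "0 < b\<^sup>2 + 1" by (simp add: add_nonneg_pos)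
    then have "0 < \<kappa>" using \<open>0 < \<theta>\<close> \<open>0 < \<delta>\<close> by (simp add: \<kappa>_def)
    have "\<kappa> \<le> \<theta>" by (simp add: \<kappa>_def)
    have "\<kappa> \<le> \<delta>\<^sup>2 / (8 * (b\<^sup>2 + 1))" by (simp add: \<kappa>_def)
    then have "\<kappa> * (8 * (b\<^sup>2 + 1)) \<le> \<delta>\<^sup>2"
      using b1 by (subst (asm) pos_le_divide_eq) auto
    then have \<kappa>b: "2 * \<kappa> * b\<^sup>2 \<le> \<delta>\<^sup>2 / 4" using \<open>0 < \<kappa>\<close> by (simp add: algebra_simps)
    define E1 where "E1 = R.window D F"
    have E1: "finite E1" "E1 \<subseteq> carrier G"
      using R.finite_window R.window_subset D F by (auto simp: E1_def)
    have "0 < min \<tau> \<epsilon>" using R.pos by simp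
    obtain \<delta>1 where "0 < \<delta>1" and few: "\<forall>\<^sub>F j in sequentially. \<forall>\<phi>\<in>Map_sofic \<alpha> X E1 \<delta>1 (d j) (\<sigma> j).
        real (card ({1..d j} - good_points E1 (min \<tau> \<epsilon>) (d j) (\<sigma> j) \<phi>)) \<le> \<kappa> * real (d j)"
      by (rule few_bad_points[OF sof E1 \<open>0 < min \<tau> \<epsilon>\<close> \<open>0 < \<kappa>\<close>])
    have "0 < 16 * \<epsilon>" using \<epsilon> by simp
    obtain E2 \<delta>2 where E2: "finite E2" "E2 \<subseteq> carrier G" and "0 < \<delta>2"
      and thin: "\<forall>\<^sub>F j in sequentially. \<forall>S. finite S \<longrightarrow> S \<subseteq> Map_sofic \<alpha> X E2 \<delta>2 (d j) (\<sigma> j) \<longrightarrow>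
           pairwise (\<lambda>\<phi> \<psi>. rho_inf (d j) \<phi> \<psi> \<ge> e) S \<longrightarrow>
           (\<exists>T\<subseteq>S. pairwise (\<lambda>\<phi> \<psi>. rho_inf (d j) \<phi> \<psi> \<ge> 16 * \<epsilon> / 4) T \<and>
              real (card S) \<le> exp (\<eta> * real (d j)) * real (card T))"
      by (rule thin_to_expansive_scale[OF sof \<open>0 < 16 * \<epsilon>\<close> exp16 \<open>0 < e\<close> \<open>0 < \<eta>\<close>])
    define E \<delta>' where "E = E1 \<union> E2 \<union> {\<one>}" and "\<delta>' = min \<delta>1 \<delta>2"
    have E: "finite E" "E \<noteq> {}" "E \<subseteq> carrier G" "0 < \<delta>'"
      using E1 E2 \<open>0 < \<delta>1\<close> \<open>0 < \<delta>2\<close> by (auto simp: E_def \<delta>'_def)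
    have more: "\<forall>\<^sub>F j in sequentially. \<forall>S. finite S \<longrightarrow> S \<subseteq> Map_sofic (restrict_action \<alpha> Y) Y E \<delta>' (d j) (\<sigma> j) \<longrightarrow>
               pairwise (\<lambda>\<phi> \<psi>. rho_inf (d j) \<phi> \<psi> \<ge> e) S \<longrightarrow>
               (\<exists>T. finite T \<and> T \<subseteq> Map_sofic \<alpha> X F \<delta> (d j) (\<sigma> j) \<and>
                  pairwise (\<lambda>\<phi> \<psi>. rho_inf (d j) \<phi> \<psi> \<ge> \<epsilon>) T \<and>
                  exp (\<eta> * real (d j)) * real (card S) \<le> real (card T))"
      using few thin large_independent_places[OF sof K']
    proof eventually_elim
      case (elim j)
      show ?case
      proof (intro allI impI)
        fix S assume S: "finite S" "S \<subseteq> Map_sofic (restrict_action \<alpha> Y) Y E \<delta>' (d j) (\<sigma> j)"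
          "pairwise (\<lambda>\<phi> \<psi>. rho_inf (d j) \<phi> \<psi> \<ge> e) S"
        have n: "0 < d j" by (rule sofic_dim_pos[OF sof])
        have perm: "\<And>s. s \<in> carrier G \<Longrightarrow> \<sigma> j s permutes {1..d j}" by (rule sofic_permutes[OF sof])
        have SX: "S \<subseteq> Map_sofic \<alpha> X E \<delta>' (d j) (\<sigma> j)"
          using S(2) Map_sofic_restrict_subset[OF \<open>Y \<subseteq> X\<close>] by blast
        have "E1 \<subseteq> E" "E2 \<subseteq> E" "\<delta>' \<le> \<delta>1" "\<delta>' \<le> \<delta>2" by (auto simp: E_def \<delta>'_def)
        then have S1: "S \<subseteq> Map_sofic \<alpha> X E1 \<delta>1 (d j) (\<sigma> j)" and S2: "S \<subseteq> Map_sofic \<alpha> X E2 \<delta>2 (d j) (\<sigma> j)"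
          using SX Map_sofic_mono[of E1 E \<delta>' \<delta>1 \<alpha> X "d j" "\<sigma> j"] Map_sofic_mono[of E2 E \<delta>' \<delta>2 \<alpha> X "d j" "\<sigma> j"]
          by blast+
        obtain S' where S': "S' \<subseteq> S" "pairwise (\<lambda>\<phi> \<psi>. rho_inf (d j) \<phi> \<psi> \<ge> 4 * \<epsilon>) S'"
          and cS: "real (card S) \<le> exp (\<eta> * real (d j)) * real (card S')"
          using elim(2) S(1,3) S2 by auto
        have finS': "finite S'" using S' S(1) finite_subset by blast
        have S'Y: "S' \<subseteq> {1..d j} \<rightarrow>\<^sub>E Y" using S' S(2) by (auto simp: Map_sofic_def)
        obtain V where V: "V \<subseteq> {1..d j}" "\<And>k v. k \<in> K - {\<one>} \<Longrightarrow> v \<in> V \<Longrightarrow> \<sigma> j k v \<notin> V"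
          "real (d j) \<le> 2 * (2 * real (card K') + 1) * real (card V)"
          using elim(3) unfolding K'_def by blast
        have "2 * \<theta> * real (d j) \<le> 2 * \<theta> * (2 * (2 * real (card K') + 1) * real (card V))"
          using V(3) \<open>0 < \<theta>\<close> by (intro mult_left_mono) auto
        also have "\<dots> = real (card V)"
        proof -
          have "2 * (1 / (4 * q)) * (2 * q * v) = v" if "q \<noteq> 0" for q v :: real using that by simp
          then show ?thesis unfolding \<theta>_def by (metis add_nonneg_pos mult_nonneg_nonneg of_nat_0_le_iff order_less_irrefl zero_le_numeral zero_less_one)
        qed
        finally have room: "\<theta> * real (d j) + \<kappa> * real (d j) \<le> real (card V)"
          using mult_right_mono[OF \<open>\<kappa> \<le> \<theta>\<close>, of "real (d j)"] by simp
        have few': "real (card ({1..d j} - good_points (R.window D F) (min \<tau> \<epsilon>) (d j) (\<sigma> j) \<phi>)) \<le> \<kappa> * real (d j)"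
          if "\<phi> \<in> S'" for \<phi>
          using elim(1) S1 S' that by (auto simp: E1_def)
        have far: "8 * \<epsilon> \<le> dist x0 y" if "y \<in> Y" for y using r0[OF that] \<epsilon>(3) by linarith
        obtain T where T: "T \<subseteq> Map_sofic \<alpha> X F \<delta> (d j) (\<sigma> j)" "finite T"
          "pairwise (\<lambda>\<phi> \<psi>. rho_inf (d j) \<phi> \<psi> \<ge> \<epsilon>) T"
          and cT: "real (card S') * (1 + 1 / real (card N) ^ card F0) powr (\<theta> * real (d j)) \<le> real (card T)"
          by (rule R.many_models[OF n perm V(1,2) D F \<open>0 < \<delta>\<close> window diam \<kappa>b \<open>Y \<subseteq> X\<close> far code finS' S'Y S'(2) few' room])
        have "(1 + x) powr (\<theta> * real (d j)) = exp (\<eta> * real (d j)) * exp (\<eta> * real (d j))"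
          using \<open>0 < x\<close> by (simp add: powr_def \<eta>_def exp_add[symmetric] algebra_simps)
        then have "exp (\<eta> * real (d j)) * (exp (\<eta> * real (d j)) * real (card S')) \<le> real (card T)"
          using cT by (simp add: x_def algebra_simps)
        moreover have "exp (\<eta> * real (d j)) * real (card S) \<le> exp (\<eta> * real (d j)) * (exp (\<eta> * real (d j)) * real (card S'))"
          using cS by (intro mult_left_mono) auto
        ultimately have "exp (\<eta> * real (d j)) * real (card S) \<le> real (card T)" by linarith
        then show "\<exists>T. finite T \<and> T \<subseteq> Map_sofic \<alpha> X F \<delta> (d j) (\<sigma> j) \<and>
                  pairwise (\<lambda>\<phi> \<psi>. rho_inf (d j) \<phi> \<psi> \<ge> \<epsilon>) T \<and>
                  exp (\<eta> * real (d j)) * real (card S) \<le> real (card T)"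
          using T by (intro exI[of _ T] conjI)
      qed
    qed
    have "Map_sofic (restrict_action \<alpha> Y) Y E \<delta>' (d j) (\<sigma> j) \<subseteq> {1..d j} \<rightarrow>\<^sub>E X" for j
      by (rule order_trans[OF Map_sofic_subset_PiE PiE_mono]) (rule \<open>Y \<subseteq> X\<close>)
    note fin = sep_number_finite[OF sofic_dim_pos[OF sof] \<open>0 < e\<close> this]
      sep_number_finite[OF sofic_dim_pos[OF sof] \<epsilon>(1) Map_sofic_subset_PiE]
    from scale_entropy_gain[OF sofic_dim_pos[OF sof] fin more]
    show "\<exists>E \<delta>'. finite E \<and> E \<noteq> {} \<and> E \<subseteq> carrier G \<and> 0 < \<delta>' \<and>
             scale_entropy d e (\<lambda>j. Map_sofic (restrict_action \<alpha> Y) Y E \<delta>' (d j) (\<sigma> j)) + ereal \<eta>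
             \<le> scale_entropy d \<epsilon> (\<lambda>j. Map_sofic \<alpha> X F \<delta> (d j) (\<sigma> j))"
      using E by (intro exI[of _ E] exI[of _ \<delta>'] conjI)
  qed
qed

text \<open>An entropy at a fixed scale is finite, because a finite code bounds the number of separated maps.\<close>

lemma scale_entropy_less_infinity:
  assumes sof: "sofic_approximation G d \<sigma>" and "0 < \<epsilon>"
  shows "scale_entropy d \<epsilon> (\<lambda>j. Map_sofic \<alpha> X F \<delta> (d j) (\<sigma> j)) < \<infinity>"
proof -
  obtain N and f :: "'a \<Rightarrow> 'a" where code: "finite N" "N \<noteq> {}" "f \<in> X \<rightarrow> N"
    "\<And>x y. x \<in> X \<Longrightarrow> y \<in> X \<Longrightarrow> f x = f y \<Longrightarrow> dist x y < \<epsilon>"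
    using compact_finite_code[OF compact_space \<open>0 < \<epsilon>\<close>] by blast
  have N: "0 < card N" using code by (simp add: card_gt_0_iff)
  have "ereal (1 / real (d j)) * log_enat (sep_number (d j) \<epsilon> (Map_sofic \<alpha> X F \<delta> (d j) (\<sigma> j))) \<le> ereal (ln (card N))" for j
  proof -
    have n: "0 < d j" by (rule sofic_dim_pos[OF sof])
    have "sep_number (d j) \<epsilon> (Map_sofic \<alpha> X F \<delta> (d j) (\<sigma> j)) \<le> enat (card N ^ d j)"
      by (rule sep_number_le_code[OF n _ code(1,3,4)]) (auto simp: Map_sofic_def)
    then obtain k where k: "sep_number (d j) \<epsilon> (Map_sofic \<alpha> X F \<delta> (d j) (\<sigma> j)) = enat k" "k \<le> card N ^ d j"
      by (cases "sep_number (d j) \<epsilon> (Map_sofic \<alpha> X F \<delta> (d j) (\<sigma> j))") auto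
    have "ereal (1 / real (d j)) * log_enat (enat k) + ereal 0 \<le> ereal (1 / real (d j)) * log_enat (enat (card N ^ d j))"
      by (rule log_growth_le[OF n]) (use k in \<open>simp flip: of_nat_power\<close>)
    also have "\<dots> = ereal (ln (card N))"
      using n N by (simp add: log_enat_def zero_enat_def ln_realpow)
    finally show ?thesis using k by simp
  qed
  then have "scale_entropy d \<epsilon> (\<lambda>j. Map_sofic \<alpha> X F \<delta> (d j) (\<sigma> j)) \<le> ereal (ln (card N))"
    unfolding scale_entropy_def by (intro Limsup_bounded) simp
  then show ?thesis by (rule le_less_trans) simp
qed

end

theorem proposition1p2:
  fixes G :: "('g, 'm) monoid_scheme"
    and X Y :: "'a::metric_space set"
    and \<alpha> :: "'g \<Rightarrow> 'a \<Rightarrow> 'a"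
    and d :: "nat \<Rightarrow> nat"
    and \<sigma> :: "nat \<Rightarrow> 'g \<Rightarrow> nat \<Rightarrow> nat"
  assumes "countable_sofic_group G"
    and "dynamical_system G X \<alpha>"
    and "expansive G X \<alpha>"
    and "weak_specification G X \<alpha>"
    and "strong_topological_Markov G X \<alpha>"
    and "sofic_approximation G d \<sigma>"
    and "sofic_entropy G d \<sigma> X \<alpha> \<ge> 0"
    and "Y \<subset> X"
    and "closedin (top_of_set X) Y"
    and "invariant_subset G \<alpha> Y"
  shows "sofic_entropy G d \<sigma> Y (restrict_action \<alpha> Y) < sofic_entropy G d \<sigma> X \<alpha>"
proof -
  note sof = assms(6)
  interpret group G using assms(1) by (simp add: countable_sofic_group_def)
  interpret group_action G X \<alpha> using assms(2) by (simp add: dynamical_system_def)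
  interpret compact_action G X \<alpha>
    by (unfold_locales) (use assms(2) in \<open>auto simp: dynamical_system_def\<close>)
  obtain c where c: "0 < c" "\<And>x y. x \<in> X \<Longrightarrow> y \<in> X \<Longrightarrow> x \<noteq> y \<Longrightarrow> \<exists>g\<in>carrier G. c < dist (\<alpha> g x) (\<alpha> g y)"
    using assms(3) unfolding expansive_def by blast
  obtain x0 where x0: "x0 \<in> X" "x0 \<notin> Y" using assms(8) by blast
  have "closed Y"
    using assms(9) compact_imp_closed[OF compact_space] closedin_closed_trans by blast
  then obtain r0 where r0: "0 < r0" "\<And>y. y \<in> Y \<Longrightarrow> r0 \<le> dist x0 y"
    using x0(2) by (force simp: closed_def open_contains_ball ball_def not_less)
  obtain \<epsilon> \<eta> :: real where "0 < \<epsilon>" "0 < \<eta>"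
    and gain: "\<forall>e>0. \<forall>F. \<forall>\<delta>>0. finite F \<longrightarrow> F \<subseteq> carrier G \<longrightarrow>
           (\<exists>E \<delta>'. finite E \<and> E \<noteq> {} \<and> E \<subseteq> carrier G \<and> 0 < \<delta>' \<and>
             scale_entropy d e (\<lambda>j. Map_sofic (restrict_action \<alpha> Y) Y E \<delta>' (d j) (\<sigma> j)) + ereal \<eta>
             \<le> scale_entropy d \<epsilon> (\<lambda>j. Map_sofic \<alpha> X F \<delta> (d j) (\<sigma> j)))"
    by (rule exponential_gain[OF sof c assms(4,5) psubset_imp_subset[OF assms(8)] x0(1) r0])
  define hX where "hX F \<delta> = scale_entropy d \<epsilon> (\<lambda>j. Map_sofic \<alpha> X F \<delta> (d j) (\<sigma> j))" for F \<delta>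
  define hY where "hY e F \<delta> = scale_entropy d e (\<lambda>j. Map_sofic (restrict_action \<alpha> Y) Y F \<delta> (d j) (\<sigma> j))" for e F \<delta>
  let ?Fs = "{F. finite F \<and> F \<noteq> {} \<and> F \<subseteq> carrier G}"
  define H where "H = (INF F\<in>?Fs. INF \<delta>\<in>{0<..}. hX F \<delta>)"
  have HX: "H \<le> sofic_entropy G d \<sigma> X \<alpha>"
    unfolding sofic_entropy_def H_def hX_def scale_entropy_def by (rule SUP_upper) (use \<open>0 < \<epsilon>\<close> in simp)
  have "{\<one>\<^bsub>G\<^esub>} \<in> ?Fs" by simp
  then have "H \<le> hX {\<one>\<^bsub>G\<^esub>} 1"
    unfolding H_def by (intro INF_lower2[of "{\<one>\<^bsub>G\<^esub>}"] INF_lower2[of 1]) auto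
  then have Hfin: "H < \<infinity>"
    using scale_entropy_less_infinity[OF sof \<open>0 < \<epsilon>\<close>] unfolding hX_def by (rule le_less_trans)
  have step: "(INF F\<in>?Fs. INF \<delta>\<in>{0<..}. hY e F \<delta>) + ereal \<eta> \<le> H" if "0 < e" for e
    unfolding H_def
  proof (intro INF_greatest)
    fix F and \<delta> :: real assume "F \<in> ?Fs" and "\<delta> \<in> {0<..}"
    then have F: "finite F" "F \<subseteq> carrier G" and \<delta>: "0 < \<delta>" by auto
    obtain E \<delta>' where E: "finite E" "E \<noteq> {}" "E \<subseteq> carrier G" "0 < \<delta>'"
      and "hY e E \<delta>' + ereal \<eta> \<le> hX F \<delta>"
      using gain[rule_format, OF \<open>0 < e\<close> \<delta> F] unfolding hX_def hY_def by blast
    moreover have "(INF F\<in>?Fs. INF \<delta>\<in>{0<..}. hY e F \<delta>) \<le> hY e E \<delta>'"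
      using E by (intro INF_lower2[of E] INF_lower2[of \<delta>']) auto
    ultimately show "(INF F\<in>?Fs. INF \<delta>\<in>{0<..}. hY e F \<delta>) + ereal \<eta> \<le> hX F \<delta>"
      by (meson add_right_mono order_trans)
  qed
  have "(INF F\<in>?Fs. INF \<delta>\<in>{0<..}. hY e F \<delta>) \<le> H - ereal \<eta>" if "0 < e" for e
    using step[OF that] by (simp add: ereal_le_minus)
  then have HY: "sofic_entropy G d \<sigma> Y (restrict_action \<alpha> Y) \<le> H - ereal \<eta>"
    unfolding sofic_entropy_def hY_def scale_entropy_def by (intro SUP_least) auto
  show ?thesis
  proof (cases H)
    case (real h)
    then have "H - ereal \<eta> < H" using \<open>0 < \<eta>\<close> by simp
    then show ?thesis using HY HX by order
  next
    (* then the entropy of Y is -\<infinity> as well, while that of X is not *)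
    case MInf
    then have "sofic_entropy G d \<sigma> Y (restrict_action \<alpha> Y) \<le> - \<infinity>" using HY by simp
    also have "\<dots> < sofic_entropy G d \<sigma> X \<alpha>" using assms(7) by auto
    finally show ?thesis .
  next
    case PInf
    then show ?thesis using Hfin by simp
  qed
qed

end
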